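(* The space $\mathcal{H}_{+}$ is a Fréchet–Schwartz, non-nuclear algebra (a Fréchet algebra under the product of Dirichlet series), and the Dirichlet monomials $e_n(s)=n^{-s}$, $n\in\mathbb{N}$, form an unconditional, non-absolute Schauder basis of $\mathcal{H}_{+}$.
   Context: $\mathcal{H}^{2}$ is the Hilbert space of Dirichlet series $\sum a_n n^{-s}$ with $\|\sum a_nn^{-s}\|_{\mathcal H^2}=(\sum_n|a_n|^2)^{1/2}<\infty$. The space $\mathcal{H}_{+}$ consists of all Dirichlet series $D=\sum a_n n^{-s}$ (complex coefficients) such that $\sum \frac{a_n}{n^{\sigma}}n^{-s}\in\mathcal{H}^2$ for every $\sigma>0$, endowed with the Fréchet topology given by the increasing seminorms $\|D\|_{2,k}=\big\|\sum \frac{a_n}{n^{1/k}}n^{-s}\big\|_{\mathcal{H}^2}=\big(\sum_n |a_n|^2n^{-2/k}\big)^{1/2}$, $k\in\mathbb{N}$. Every series in $\mathcal H_+$ converges absolutely for $\operatorname{Re}s>\frac12$; the product is the pointwise product of the functions there (equivalently, Dirichlet convolution of the coefficients). A Fréchet algebra is a Fréchet space that is an algebra with continuous multiplication. A sequence $(e_n)$ in a locally convex space $E$ is a Schauder basis if each $x\in E$ has a unique expansion $x=\sum_{n=1}^\infty x_ne_n$; it is unconditional if $\sum_n x_{\pi(n)}e_{\pi(n)}$ converges for every permutation $\pi$ of $\mathbb{N}$ and every $x$; it is absolute if for every continuous seminorm $p$ on $E$ there are a continuous seminorm $q$ and $C>0$ with $\sum_n|x_n|\,p(e_n)\le C q(x)$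 for all $x\in E$. *)

theory Defs
  imports "HOL-Analysis.Analysis" "HOL-Library.Function_Algebras"
begin

section \<open>Locally convex spaces\<close>

text \<open>
  A complex topological vector space is given by a scalar multiplication \<open>sc\<close> on an ambient
  type and an abstract topology \<open>T\<close>; its underlying vector space is the subspace \<open>topspace T\<close>.
\<close>

definition tvs :: "(complex \<Rightarrow> 'v \<Rightarrow> 'v) \<Rightarrow> 'v::ab_group_add topology \<Rightarrow> bool" where
  "tvs sc T \<longleftrightarrow>
     vector_space sc \<and> module.subspace sc (topspace T) \<and>
     continuous_map (prod_topology T T) T (\<lambda>(x, y). x + y) \<and>
     continuous_map (prod_topology euclidean T) T (\<lambda>(c, x). sc c x)"

definition nbhd_zero :: "'v::ab_group_add topology \<Rightarrow> 'v set \<Rightarrow> bool" where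
  "nbhd_zero T U \<longleftrightarrow> U \<subseteq> topspace T \<and> (\<exists>W. openin T W \<and> 0 \<in> W \<and> W \<subseteq> U)"

definition convex_set :: "(complex \<Rightarrow> 'v \<Rightarrow> 'v) \<Rightarrow> 'v::ab_group_add set \<Rightarrow> bool" where
  "convex_set sc U \<longleftrightarrow>
     (\<forall>x\<in>U. \<forall>y\<in>U. \<forall>t::real. 0 \<le> t \<and> t \<le> 1 \<longrightarrow>
        sc (of_real t) x + sc (of_real (1 - t)) y \<in> U)"

definition absolutely_convex_set :: "(complex \<Rightarrow> 'v \<Rightarrow> 'v) \<Rightarrow> 'v::ab_group_add set \<Rightarrow> bool" where
  "absolutely_convex_set sc U \<longleftrightarrow>
     (\<forall>x\<in>U. \<forall>y\<in>U. \<forall>a b. cmod a + cmod b \<le> 1 \<longrightarrow> sc a x + sc b y \<in> U)"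

definition locally_convex_space :: "(complex \<Rightarrow> 'v \<Rightarrow> 'v) \<Rightarrow> 'v::ab_group_add topology \<Rightarrow> bool" where
  "locally_convex_space sc T \<longleftrightarrow>
     tvs sc T \<and> (\<forall>U. nbhd_zero T U \<longrightarrow> (\<exists>V. nbhd_zero T V \<and> convex_set sc V \<and> V \<subseteq> U))"

definition tvs_Cauchy :: "'v::ab_group_add topology \<Rightarrow> (nat \<Rightarrow> 'v) \<Rightarrow> bool" where
  "tvs_Cauchy T x \<longleftrightarrow>
     range x \<subseteq> topspace T \<and> (\<forall>U. nbhd_zero T U \<longrightarrow> (\<exists>N. \<forall>m\<ge>N. \<forall>n\<ge>N. x m - x n \<in> U))"

text \<open>Sequential completeness suffices below because the topology is metrizable.\<close>

definition frechet_space :: "(complex \<Rightarrow> 'v \<Rightarrow> 'v) \<Rightarrow> 'v::ab_group_add topology \<Rightarrow> bool" where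
  "frechet_space sc T \<longleftrightarrow>
     locally_convex_space sc T \<and> metrizable_space T \<and>
     (\<forall>x. tvs_Cauchy T x \<longrightarrow> (\<exists>l. limitin T x l sequentially))"

definition frechet_algebra ::
  "(complex \<Rightarrow> 'v \<Rightarrow> 'v) \<Rightarrow> 'v::ab_group_add topology \<Rightarrow> ('v \<Rightarrow> 'v \<Rightarrow> 'v) \<Rightarrow> bool" where
  "frechet_algebra sc T mul \<longleftrightarrow>
     frechet_space sc T \<and>
     (\<forall>x\<in>topspace T. \<forall>y\<in>topspace T. mul x y \<in> topspace T) \<and>
     (\<forall>x\<in>topspace T. \<forall>y\<in>topspace T. \<forall>z\<in>topspace T.
        mul (mul x y) z = mul x (mul y z) \<and>
        mul (x + y) z = mul x z + mul y z \<and>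
        mul x (y + z) = mul x y + mul x z) \<and>
     (\<forall>c. \<forall>x\<in>topspace T. \<forall>y\<in>topspace T.
        mul (sc c x) y = sc c (mul x y) \<and> mul x (sc c y) = sc c (mul x y)) \<and>
     continuous_map (prod_topology T T) T (\<lambda>(x, y). mul x y)"

text \<open>
  Schwartz spaces: every absolutely convex zero neighbourhood \<open>U\<close> admits a zero neighbourhood
  \<open>V\<close> that is precompact with respect to (the gauge of) \<open>U\<close>.
\<close>

definition schwartz_space :: "(complex \<Rightarrow> 'v \<Rightarrow> 'v) \<Rightarrow> 'v::ab_group_add topology \<Rightarrow> bool" where
  "schwartz_space sc T \<longleftrightarrow>
     locally_convex_space sc T \<and>
     (\<forall>U. nbhd_zero T U \<and> absolutely_convex_set sc U \<longrightarrow>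
        (\<exists>V. nbhd_zero T V \<and>
           (\<forall>\<epsilon>::real. \<epsilon> > 0 \<longrightarrow>
              (\<exists>F. finite F \<and> F \<subseteq> V \<and> V \<subseteq> (\<Union>x\<in>F. (\<lambda>u. x + sc (of_real \<epsilon>) u) ` U)))))"

definition continuous_seminorm ::
  "(complex \<Rightarrow> 'v \<Rightarrow> 'v) \<Rightarrow> 'v::ab_group_add topology \<Rightarrow> ('v \<Rightarrow> real) \<Rightarrow> bool" where
  "continuous_seminorm sc T p \<longleftrightarrow>
     (\<forall>x\<in>topspace T. 0 \<le> p x) \<and>
     (\<forall>x\<in>topspace T. \<forall>y\<in>topspace T. p (x + y) \<le> p x + p y) \<and>
     (\<forall>c. \<forall>x\<in>topspace T. p (sc c x) = cmod c * p x) \<and>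
     continuous_map T euclideanreal p"

section \<open>Nuclear spaces\<close>

text \<open>
  For a continuous seminorm \<open>p\<close> let \<open>E\<^sub>p\<close> be the local Banach space, i.e. the completion of
  \<open>E / ker p\<close>. An element of \<open>E\<^sub>p\<close> is represented by a \<open>p\<close>-Cauchy sequence in \<open>E\<close>, and
  \<open>local_norm p\<close> is the norm of \<open>E\<^sub>p\<close> in terms of such representatives.
\<close>

definition local_Cauchy :: "'v::ab_group_add topology \<Rightarrow> ('v \<Rightarrow> real) \<Rightarrow> (nat \<Rightarrow> 'v) \<Rightarrow> bool" where
  "local_Cauchy T p u \<longleftrightarrow>
     range u \<subseteq> topspace T \<and> (\<forall>\<epsilon>>0. \<exists>N. \<forall>m\<ge>N. \<forall>n\<ge>N. p (u m - u n) < \<epsilon>)"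

definition local_norm :: "('v \<Rightarrow> real) \<Rightarrow> (nat \<Rightarrow> 'v) \<Rightarrow> real" where
  "local_norm p u = lim (\<lambda>k. p (u k))"

text \<open>
  The canonical map \<open>E\<^sub>q \<rightarrow> E\<^sub>p\<close> (for \<open>p \<le> q\<close>) is nuclear: it has the form
  \<open>x \<mapsto> (\<Sum>j. y\<^sub>j(x) u\<^sub>j)\<close> with \<open>y\<^sub>j \<in> (E\<^sub>q)'\<close>, \<open>u\<^sub>j \<in> E\<^sub>p\<close> and \<open>(\<Sum>j. \<parallel>y\<^sub>j\<parallel> \<parallel>u\<^sub>j\<parallel>) < \<infinity>\<close>.
  A functional in \<open>(E\<^sub>q)'\<close> of norm at most \<open>c\<close> is a linear functional on \<open>E\<close> bounded by \<open>c q\<close>;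
  the identity is required on \<open>E\<close>, whose image is dense in \<open>E\<^sub>q\<close>.
\<close>

definition nuclear_canonical_map ::
  "(complex \<Rightarrow> 'v \<Rightarrow> 'v) \<Rightarrow> 'v::ab_group_add topology \<Rightarrow> ('v \<Rightarrow> real) \<Rightarrow> ('v \<Rightarrow> real) \<Rightarrow> bool" where
  "nuclear_canonical_map sc T q p \<longleftrightarrow>
     (\<exists>(y :: nat \<Rightarrow> 'v \<Rightarrow> complex) (c :: nat \<Rightarrow> real) (u :: nat \<Rightarrow> nat \<Rightarrow> 'v).
        (\<forall>j. \<forall>x\<in>topspace T. \<forall>x'\<in>topspace T. y j (x + x') = y j x + y j x') \<and>
        (\<forall>j a. \<forall>x\<in>topspace T. y j (sc a x) = a * y j x) \<and>
        (\<forall>j. 0 \<le> c j \<and> (\<forall>x\<in>topspace T. cmod (y j x) \<le> c j * q x)) \<and>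
        (\<forall>j. local_Cauchy T p (u j)) \<and>
        summable (\<lambda>j. c j * local_norm p (u j)) \<and>
        (\<forall>x\<in>topspace T.
           (\<lambda>N. local_norm p (\<lambda>k. x - (\<Sum>j<N. sc (y j x) (u j k)))) \<longlonglongrightarrow> 0))"

definition nuclear_space :: "(complex \<Rightarrow> 'v \<Rightarrow> 'v) \<Rightarrow> 'v::ab_group_add topology \<Rightarrow> bool" where
  "nuclear_space sc T \<longleftrightarrow>
     locally_convex_space sc T \<and>
     (\<forall>p. continuous_seminorm sc T p \<longrightarrow>
        (\<exists>q. continuous_seminorm sc T q \<and> (\<forall>x\<in>topspace T. p x \<le> q x) \<and>
             nuclear_canonical_map sc T q p))"

section \<open>Schauder bases\<close>

definition expansion ::
  "(complex \<Rightarrow> 'v \<Rightarrow> 'v) \<Rightarrow> 'v::ab_group_add topology \<Rightarrow> (nat \<Rightarrow> 'v) \<Rightarrow> (nat \<Rightarrow> complex) \<Rightarrow> 'v \<Rightarrow> bool" where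
  "expansion sc T e c x \<longleftrightarrow> limitin T (\<lambda>N. \<Sum>n<N. sc (c n) (e n)) x sequentially"

definition schauder_basis ::
  "(complex \<Rightarrow> 'v \<Rightarrow> 'v) \<Rightarrow> 'v::ab_group_add topology \<Rightarrow> (nat \<Rightarrow> 'v) \<Rightarrow> bool" where
  "schauder_basis sc T e \<longleftrightarrow>
     range e \<subseteq> topspace T \<and> (\<forall>x\<in>topspace T. \<exists>!c. expansion sc T e c x)"

definition unconditional_basis ::
  "(complex \<Rightarrow> 'v \<Rightarrow> 'v) \<Rightarrow> 'v::ab_group_add topology \<Rightarrow> (nat \<Rightarrow> 'v) \<Rightarrow> bool" where
  "unconditional_basis sc T e \<longleftrightarrow>
     schauder_basis sc T e \<and>
     (\<forall>x\<in>topspace T. \<forall>c. expansion sc T e c x \<longrightarrow>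
        (\<forall>\<pi>. bij \<pi> \<longrightarrow> (\<exists>z. expansion sc T (e \<circ> \<pi>) (c \<circ> \<pi>) z)))"

definition absolute_basis ::
  "(complex \<Rightarrow> 'v \<Rightarrow> 'v) \<Rightarrow> 'v::ab_group_add topology \<Rightarrow> (nat \<Rightarrow> 'v) \<Rightarrow> bool" where
  "absolute_basis sc T e \<longleftrightarrow>
     schauder_basis sc T e \<and>
     (\<forall>p. continuous_seminorm sc T p \<longrightarrow>
        (\<exists>q C. continuous_seminorm sc T q \<and> C > 0 \<and>
           (\<forall>x\<in>topspace T. \<forall>c. expansion sc T e c x \<longrightarrow>
              summable (\<lambda>n. cmod (c n) * p (e n)) \<and>
              (\<Sum>n. cmod (c n) * p (e n)) \<le> C * q x)))"

section \<open>The space of Dirichlet series\<close>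

text \<open>
  A Dirichlet series \<open>\<Sum>n\<ge>1. a\<^sub>n n\<^sup>-\<^sup>s\<close> is represented by its coefficient function \<open>a\<close>,
  normalised by \<open>a 0 = 0\<close>. Vector addition is the pointwise one of \<open>Function_Algebras\<close>.
  In the definitions below \<open>0 powr t = 0\<close>, so the term at \<open>0\<close> always vanishes.
\<close>

definition H2 :: "(nat \<Rightarrow> complex) set" where
  "H2 = {a. a 0 = 0 \<and> summable (\<lambda>n. (cmod (a n))\<^sup>2)}"

definition H2_norm :: "(nat \<Rightarrow> complex) \<Rightarrow> real" where
  "H2_norm a = sqrt (\<Sum>n. (cmod (a n))\<^sup>2)"

definition H_plus :: "(nat \<Rightarrow> complex) set" where
  "H_plus = {a. a 0 = 0 \<and> (\<forall>\<sigma>::real. \<sigma> > 0 \<longrightarrow> (\<lambda>n. a n / of_real (real n powr \<sigma>)) \<in> H2)}"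

definition H_plus_seminorm :: "nat \<Rightarrow> (nat \<Rightarrow> complex) \<Rightarrow> real" where
  "H_plus_seminorm k a = H2_norm (\<lambda>n. a n / of_real (real n powr (1 / real k)))"

definition H_plus_topology :: "(nat \<Rightarrow> complex) topology" where
  "H_plus_topology =
     topology_generated_by
       {{b \<in> H_plus. H_plus_seminorm k (b - a) < r} | a k r. a \<in> H_plus \<and> k \<ge> 1 \<and> r > 0}"

definition dirichlet_scale :: "complex \<Rightarrow> (nat \<Rightarrow> complex) \<Rightarrow> (nat \<Rightarrow> complex)" where
  "dirichlet_scale c a = (\<lambda>n. c * a n)"

text \<open>
  Dirichlet convolution; lemma \<open>dirichlet_mult_sums\<close> below identifies it with the pointwise
  product of functions. At \<open>n = 0\<close> the sum is over an infinite set and hence \<open>0\<close>.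
\<close>

definition dirichlet_mult :: "(nat \<Rightarrow> complex) \<Rightarrow> (nat \<Rightarrow> complex) \<Rightarrow> (nat \<Rightarrow> complex)" where
  "dirichlet_mult a b = (\<lambda>n. \<Sum>d | d dvd n. a d * b (n div d))"

text \<open>The Dirichlet series \<open>s \<mapsto> n\<^sup>-\<^sup>s\<close>.\<close>

definition dirichlet_monomial :: "nat \<Rightarrow> (nat \<Rightarrow> complex)" where
  "dirichlet_monomial n = (\<lambda>m. if m = n then 1 else 0)"

definition dirichlet_eval :: "(nat \<Rightarrow> complex) \<Rightarrow> complex \<Rightarrow> complex" where
  "dirichlet_eval a s = (\<Sum>n. a n * of_nat n powr - s)"

lemma topspace_H_plus [simp]: "topspace H_plus_topology = H_plus"
proof
  show "topspace H_plus_topology \<subseteq> H_plus"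
    by (auto simp: H_plus_topology_def topology_generated_by_topspace)
next
  have "a \<in> topspace H_plus_topology" if "a \<in> H_plus" for a
  proof -
    have "a \<in> {b \<in> H_plus. H_plus_seminorm 1 (b - a) < 1}"
      using that by (simp add: H_plus_seminorm_def H2_norm_def)
    then show ?thesis
      unfolding H_plus_topology_def topology_generated_by_topspace
      using that by (intro UnionI[of "{b \<in> H_plus. H_plus_seminorm 1 (b - a) < 1}"])
        (blast intro: zero_less_one order_refl)
  qed
  then show "H_plus \<subseteq> topspace H_plus_topology" by blast
qed

lemma dirichlet_eval_monomial:
  assumes "n \<ge> 1"
  shows "dirichlet_eval (dirichlet_monomial n) s = of_nat n powr - s"
proof -
  have "(\<lambda>m. dirichlet_monomial n m * of_nat m powr - s) =
        (\<lambda>m. if m = n then of_nat m powr - s else 0)"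
    by (auto simp: dirichlet_monomial_def)
  then show ?thesis
    using sums_single[of n "\<lambda>m. of_nat m powr - s"]
    by (simp add: dirichlet_eval_def sums_iff)
qed

lemma H_plus_abs_summable:
  assumes a: "a \<in> H_plus" and s: "Re s > 1/2"
  shows "summable (\<lambda>n. norm (a n * of_nat n powr - s))"
proof -
  define \<sigma> where "\<sigma> = (Re s - 1/2) / 2"
  define t where "t = Re s - \<sigma>"
  have \<sigma>: "\<sigma> > 0" and t: "2 * t > 1" using s by (auto simp: \<sigma>_def t_def field_simps)
  have 1: "summable (\<lambda>n. (cmod (a n / of_real (real n powr \<sigma>)))\<^sup>2)"
    using a \<sigma> by (auto simp: H_plus_def H2_def)
  have 2: "summable (\<lambda>n. real n powr (- (2 * t)))"
    using t by (subst summable_real_powr_iff) auto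
  have le: "norm (a n * of_nat n powr - s)
        \<le> (cmod (a n / of_real (real n powr \<sigma>)))\<^sup>2 + real n powr (- (2 * t))" for n
  proof (cases "n = 0")
    case True
    then show ?thesis by simp
  next
    case False
    define x where "x = cmod (a n / of_real (real n powr \<sigma>))"
    define y where "y = real n powr (- t)"
    have "cmod (of_nat n powr - s) = real n powr (- Re s)"
      using False by (simp add: norm_powr_real_powr)
    also have "\<dots> = real n powr (- \<sigma>) * y"
      by (simp add: y_def t_def flip: powr_add)
    finally have "norm (a n * of_nat n powr - s) = x * y"
      by (simp add: x_def norm_mult norm_divide norm_inverse powr_minus divide_inverse)
    moreover have "x * y \<le> x\<^sup>2 + y\<^sup>2"
    proof -
      have "0 \<le> x * y" by (simp add: x_def y_def)
      then show ?thesis using sum_squares_bound[of x y] by linarith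
    qed
    moreover have "y\<^sup>2 = real n powr (- (2 * t))"
      by (simp add: y_def power2_eq_square flip: powr_add)
    ultimately show ?thesis by (simp only: x_def)
  qed
  show ?thesis
    by (rule summable_comparison_test'[OF summable_add[OF 1 2]]) (use le in auto)
qed

lemma dirichlet_mult_sums:
  assumes a: "a \<in> H_plus" and b: "b \<in> H_plus" and s: "Re s > 1/2"
  shows "(\<lambda>n. dirichlet_mult a b n * of_nat n powr - s) sums
           (dirichlet_eval a s * dirichlet_eval b s)"
proof -
  define f where "f = (\<lambda>n. a n * of_nat n powr - s)"
  define g where "g = (\<lambda>n. b n * of_nat n powr - s)"
  define P where "P = (\<lambda>(d::nat, e::nat). f d * g e)"
  have f: "summable (\<lambda>n. norm (f n))" and g: "summable (\<lambda>n. norm (g n))"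
    unfolding f_def g_def using H_plus_abs_summable assms by auto
  have hf: "(f has_sum dirichlet_eval a s) UNIV" and hg: "(g has_sum dirichlet_eval b s) UNIV"
    using norm_summable_imp_has_sum[OF f] norm_summable_imp_has_sum[OF g]
      summable_norm_cancel[OF f] summable_norm_cancel[OF g]
    by (auto simp: dirichlet_eval_def f_def g_def)
  have nf: "(\<lambda>n. norm (f n)) summable_on UNIV" and ng: "(\<lambda>n. norm (g n)) summable_on UNIV"
    using f g by (simp_all add: norm_summable_imp_summable_on)
  have absP: "(\<lambda>x. norm (P x)) summable_on (UNIV \<times> UNIV)"
  proof -
    have "(\<lambda>e. norm (P (d, e))) summable_on UNIV" for d
      using summable_on_cmult_right[OF ng, of "norm (f d)"] by (simp add: P_def norm_mult)
    moreover have "norm (\<Sum>\<^sub>\<infinity>e. norm (P (d, e))) = norm (f d) * (\<Sum>\<^sub>\<infinity>e. norm (g e))" for d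
      by (simp add: P_def norm_mult infsum_cmult_right' abs_mult infsum_nonneg)
    moreover have "(\<lambda>d. norm (f d) * (\<Sum>\<^sub>\<infinity>e. norm (g e))) summable_on UNIV"
      by (rule summable_on_cmult_left[OF nf])
    ultimately show ?thesis
      unfolding Infinite_Sum.abs_summable_on_Sigma_iff by simp
  qed
  have P: "(P has_sum (dirichlet_eval a s * dirichlet_eval b s)) (UNIV \<times> UNIV)"
  proof -
    have "infsum P (UNIV \<times> UNIV) = (\<Sum>\<^sub>\<infinity>d. \<Sum>\<^sub>\<infinity>e. P (d, e))"
      using infsum_Sigma_banach[OF Infinite_Sum.abs_summable_summable[OF absP]] by simp
    also have "\<dots> = dirichlet_eval a s * dirichlet_eval b s"
      using infsumI[OF hf] infsumI[OF hg]
      by (simp add: P_def infsum_cmult_right' infsum_cmult_left')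
    finally show ?thesis
      using Infinite_Sum.abs_summable_summable[OF absP] has_sum_infsum by fastforce
  qed
  have P': "(P has_sum (dirichlet_eval a s * dirichlet_eval b s)) ({1..} \<times> {1..})"
  proof (subst has_sum_cong_neutral[where T = "UNIV \<times> UNIV" and g = P])
    show "(P has_sum (dirichlet_eval a s * dirichlet_eval b s)) (UNIV \<times> UNIV)" by (fact P)
    have "f 0 = 0" "g 0 = 0" by (simp_all add: f_def g_def)
    then show "P x = 0" if "x \<in> UNIV \<times> UNIV - {1..} \<times> {1..}" for x
      using that by (cases x) (auto simp: P_def not_less_eq_eq)
  qed auto
  define D where "D = (SIGMA n:{1::nat..}. {d. d dvd n})"
  have S: "((\<lambda>(n, d). f d * g (n div d)) has_sum (dirichlet_eval a s * dirichlet_eval b s)) D"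
  proof (subst has_sum_reindex_bij_witness[where T = "{1..} \<times> {1..}" and h = P
        and i = "\<lambda>(d, e). (d * e, d)" and j = "\<lambda>(n, d). (d, n div d)"])
    show "(P has_sum (dirichlet_eval a s * dirichlet_eval b s)) ({1..} \<times> {1..})" by (fact P')
  qed (auto simp: D_def P_def dvd_div_eq_0_iff Suc_le_eq intro: Nat.gr0I)
  have F: "((\<lambda>d. f d * g (n div d)) has_sum (dirichlet_mult a b n * of_nat n powr - s)) {d. d dvd n}"
    if n: "n \<in> {1..}" for n
  proof -
    have fin: "finite {d. d dvd n}" using n by simp
    have "(\<Sum>d | d dvd n. f d * g (n div d)) = dirichlet_mult a b n * of_nat n powr - s"
      unfolding dirichlet_mult_def sum_distrib_right
    proof (rule sum.cong)
      fix d assume "d \<in> {d. d dvd n}"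
      then obtain e where "n = d * e" by (auto elim: dvdE)
      moreover from this n have "d > 0" by (cases d) auto
      ultimately show "f d * g (n div d) = a d * b (n div d) * of_nat n powr - s"
        by (simp add: f_def g_def powr_times_real)
    qed simp
    then show ?thesis using has_sum_finite[OF fin] by metis
  qed
  have "((\<lambda>n. dirichlet_mult a b n * of_nat n powr - s) has_sum
          (dirichlet_eval a s * dirichlet_eval b s)) {1..}"
    using has_sum_SigmaD[OF S[unfolded D_def]] F by simp
  then have "((\<lambda>n. dirichlet_mult a b n * of_nat n powr - s) has_sum
          (dirichlet_eval a s * dirichlet_eval b s)) UNIV"
    by (subst has_sum_cong_neutral[where T = "{1..}"
          and g = "\<lambda>n. dirichlet_mult a b n * of_nat n powr - s"]) (auto simp: not_less_eq_eq)
  then show ?thesis by (rule has_sum_imp_sums)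
qed

end

(* The square of the k-th seminorm is a weighted l^2 norm with weight n^(-2/k), so all linear statements
   are about diagonal maps between weighted l^2 spaces: passing from k+1 to k multiplies the n-th
   normalised coordinate by a null sequence (Schwartz), while from k to 1 the diagonal n^(1/k - 1)
   is not summable (not nuclear), and tails of l^2 sequences vanish along every exhaustion of the
   index set (unconditional basis).  For the product, Cauchy-Schwarz costs the number of divisors
   of n, which is O(n^epsilon) and hence absorbed by doubling k. *)

theory Submission
  imports Defs
begin

section \<open>Topologies given by an increasing sequence of seminorms\<close>

text \<open>Both negative results rest on one remark: since n^(-1/k) \<le> 1 for n \<ge> 1, every
  continuous seminorm is, on finitely supported sequences, at most a constant times the unweighted
  l^2 norm. An unknown seminorm q may thus be traded for that norm whatever index controls it, and
  only one target seminorm has to be chosen: coordinate weights 1/n for the trace and n^(-1/2) for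
  absoluteness. Each choice leads to harmonic numbers, so divergence of the harmonic series is the
  only obstruction used. In the nuclear case the vectors u_j live in a completion and are visible
  only through Cauchy sequences. No coordinates of the limits are formed: the trace inequality is
  proved for the representatives in the space itself, and the limits are taken afterwards in the
  scalar inequality. Absoluteness is refuted directly and not deduced from the failure of
  nuclearity, so no theorem on bases in nuclear spaces enters. What depends only on an increasing,
  definite family of seminorms is kept apart from sequences.\<close>

locale graded_seminorms = vector_space scale
  for scale :: "complex \<Rightarrow> 'v::ab_group_add \<Rightarrow> 'v" +
  fixes E :: "'v set" and p :: "nat \<Rightarrow> 'v \<Rightarrow> real"
  assumes subspace_E: "subspace E"
    and p_nonneg: "\<And>k x. x \<in> E \<Longrightarrow> 0 \<le> p k x"
    and p_triangle: "\<And>k x y. x \<in> E \<Longrightarrow> y \<in> E \<Longrightarrow> p k (x + y) \<le> p k x + p k y"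
    and p_scale: "\<And>k c x. x \<in> E \<Longrightarrow> p k (scale c x) = cmod c * p k x"
    and p_mono: "\<And>m k x. x \<in> E \<Longrightarrow> m \<le> k \<Longrightarrow> p m x \<le> p k x"
    and p_definite: "\<And>x. x \<in> E \<Longrightarrow> p 0 x = 0 \<Longrightarrow> x = 0"
begin

text \<open>Kept in the literal shape of \<open>H_plus_topology\<close>, so that the two topologies
  are identified later by comparing their generating families.\<close>

definition T :: "'v topology" where
  "T = topology_generated_by {{b \<in> E. p k (b - a) < r} | a k r. a \<in> E \<and> r > 0}"

lemma E_zero [simp]: "0 \<in> E"
  and E_add: "x \<in> E \<Longrightarrow> y \<in> E \<Longrightarrow> x + y \<in> E"
  and E_diff: "x \<in> E \<Longrightarrow> y \<in> E \<Longrightarrow> x - y \<in> E"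
  and E_scale: "x \<in> E \<Longrightarrow> scale c x \<in> E"
  using subspace_E by (simp_all add: subspace_0 subspace_add subspace_diff subspace_scale)

lemma p_zero [simp]: "p k 0 = 0"
  using p_scale[of 0 k 0] by simp

lemma p_minus_commute:
  assumes "x \<in> E" "y \<in> E"
  shows "p k (x - y) = p k (y - x)"
  using p_scale[OF E_diff[OF assms], of k "-1"] by (simp add: scale_minus_left)

lemma p_triangle3:
  assumes "x \<in> E" "y \<in> E" "z \<in> E"
  shows "p k (x - z) \<le> p k (x - y) + p k (y - z)"
  using p_triangle[OF E_diff[OF assms(1,2)] E_diff[OF assms(2,3)], of k] by simp

lemma p_reverse_triangle:
  assumes "x \<in> E" "y \<in> E"
  shows "\<bar>p k x - p k y\<bar> \<le> p k (x - y)"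
  using p_triangle3[of x y 0 k] p_triangle3[of y x 0 k] p_minus_commute[of x y k] assms by auto

lemma topspace_T [simp]: "topspace T = E"
proof -
  have "a \<in> \<Union>{{b \<in> E. p k (b - a) < r} | a k r. a \<in> E \<and> r > 0}" if "a \<in> E" for a
  proof (rule UnionI)
    show "{b \<in> E. p 0 (b - a) < 1} \<in> {{b \<in> E. p k (b - a) < r} | a k r. a \<in> E \<and> r > 0}"
      using that zero_less_one by blast
    show "a \<in> {b \<in> E. p 0 (b - a) < 1}" using that by simp
  qed
  then show ?thesis
    unfolding T_def topology_generated_by_topspace by blast
qed

lemma openin_ball:
  assumes "a \<in> E"
  shows "openin T {b \<in> E. p k (b - a) < r}"
proof (cases "r > 0")
  case True
  then show ?thesis
    unfolding T_def using assms by (intro topology_generated_by_Basis) blast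
next
  case False
  then have "{b \<in> E. p k (b - a) < r} = {}"
    using p_nonneg[OF E_diff[OF _ assms]] by (smt (verit) Collect_empty_eq)
  then show ?thesis by (simp only: openin_empty)
qed

text \<open>Since the seminorms increase, the balls form a base and not merely a subbase.\<close>

lemma openin_T_iff:
  "openin T U \<longleftrightarrow> U \<subseteq> E \<and> (\<forall>x\<in>U. \<exists>k r. r > 0 \<and> {y \<in> E. p k (y - x) < r} \<subseteq> U)"
proof
  assume "openin T U"
  then have "generate_topology_on {{b \<in> E. p k (b - a) < r} | a k r. a \<in> E \<and> r > 0} U"
    unfolding T_def by (rule openin_topology_generated_by)
  then show "U \<subseteq> E \<and> (\<forall>x\<in>U. \<exists>k r. r > 0 \<and> {y \<in> E. p k (y - x) < r} \<subseteq> U)"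
  proof induction
    case Empty
    then show ?case by simp
  next
    case (Int A B)
    have "\<exists>k r. r > 0 \<and> {y \<in> E. p k (y - x) < r} \<subseteq> A \<inter> B" if "x \<in> A \<inter> B" for x
    proof -
      from bspec[OF conjunct2[OF Int.IH(1)] IntD1[OF that]]
      obtain k r where A: "r > 0" "{y \<in> E. p k (y - x) < r} \<subseteq> A" by (elim exE conjE)
      from bspec[OF conjunct2[OF Int.IH(2)] IntD2[OF that]]
      obtain m s where B: "s > 0" "{y \<in> E. p m (y - x) < s} \<subseteq> B" by (elim exE conjE)
      have x: "x \<in> E" using Int.IH(1) that by (meson IntD1 subsetD)
      have "{y \<in> E. p (max k m) (y - x) < min r s} \<subseteq> A \<inter> B"
      proof
        fix y assume y: "y \<in> {y \<in> E. p (max k m) (y - x) < min r s}"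
        then have "p k (y - x) < r" "p m (y - x) < s"
          using p_mono[OF E_diff[of y x], of k "max k m"] p_mono[OF E_diff[of y x], of m "max k m"] x
          by auto
        then show "y \<in> A \<inter> B" using A B y by blast
      qed
      then show ?thesis using A(1) B(1) by (metis min_less_iff_conj)
    qed
    then show ?case using Int.IH by (meson le_infI1)
  next
    case (UN K)
    have "\<exists>k r. r > 0 \<and> {y \<in> E. p k (y - x) < r} \<subseteq> \<Union>K" if "x \<in> \<Union>K" for x
      using UN.IH that by (meson UnionE Union_upper subset_trans)
    then show ?case using UN.IH by (meson Union_least)
  next
    case (Basis S)
    then obtain a k r where S: "S = {b \<in> E. p k (b - a) < r}" "a \<in> E" "r > 0" by blast
    have "\<exists>k r. r > 0 \<and> {y \<in> E. p k (y - x) < r} \<subseteq> S" if x: "x \<in> S" for x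
    proof (intro exI conjI)
      show "r - p k (x - a) > 0" using x S by simp
      show "{y \<in> E. p k (y - x) < r - p k (x - a)} \<subseteq> S"
        using x S p_triangle3[of _ x a k] by fastforce
    qed
    then show ?case using S by blast
  qed
next
  assume U: "U \<subseteq> E \<and> (\<forall>x\<in>U. \<exists>k r. r > 0 \<and> {y \<in> E. p k (y - x) < r} \<subseteq> U)"
  show "openin T U"
  proof (subst openin_subopen, intro ballI)
    fix x assume x: "x \<in> U"
    then obtain k r where "r > 0" "{y \<in> E. p k (y - x) < r} \<subseteq> U" using U by blast
    then show "\<exists>W. openin T W \<and> x \<in> W \<and> W \<subseteq> U"
      using x U openin_ball[of x k r] by (intro exI[of _ "{y \<in> E. p k (y - x) < r}"]) auto
  qed
qed

section \<open>Neighbourhoods of zero and sequential limits\<close>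

lemma openin_T_ball:
  assumes "openin T U" "x \<in> U"
  obtains k r where "r > 0" "{y \<in> E. p k (y - x) < r} \<subseteq> U"
  using bspec[OF conjunct2[OF assms(1)[unfolded openin_T_iff]] assms(2)] by (elim exE conjE)

lemma nbhd_zero_ballE:
  assumes "nbhd_zero T U"
  obtains k r where "r > 0" "{y \<in> E. p k y < r} \<subseteq> U"
proof -
  from assms obtain W where W: "openin T W" "0 \<in> W" "W \<subseteq> U" by (auto simp: nbhd_zero_def)
  then obtain k r where "r > 0" "{y \<in> E. p k (y - 0) < r} \<subseteq> W" by (elim openin_T_ball)
  then show thesis using that[of r k] W(3) by simp
qed

lemma nbhd_zero_ball:
  assumes "r > 0"
  shows "nbhd_zero T {y \<in> E. p k y < r}"
  unfolding nbhd_zero_def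
proof (intro conjI exI)
  show "openin T {y \<in> E. p k y < r}" using openin_ball[of 0 k r] by simp
qed (use assms in auto)

lemma limitin_T_iff:
  assumes "range x \<subseteq> E"
  shows "limitin T x l sequentially \<longleftrightarrow> l \<in> E \<and> (\<forall>k. (\<lambda>n. p k (x n - l)) \<longlonglongrightarrow> 0)"
proof
  assume L: "limitin T x l sequentially"
  then have l: "l \<in> E" by (simp add: limitin_def)
  have "(\<lambda>n. p k (x n - l)) \<longlonglongrightarrow> 0" for k
  proof (rule LIMSEQ_I)
    fix r :: real assume r: "r > 0"
    then obtain N where "\<forall>n\<ge>N. x n \<in> {y \<in> E. p k (y - l) < r}"
      using conjunct2[OF L[unfolded limitin_sequentially], rule_format, of "{y \<in> E. p k (y - l) < r}"]
        openin_ball[OF l, of k r] l by auto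
    then show "\<exists>N. \<forall>n\<ge>N. norm (p k (x n - l) - 0) < r"
      by (intro exI[of _ N]) (simp add: abs_of_nonneg p_nonneg E_diff l)
  qed
  with l show "l \<in> E \<and> (\<forall>k. (\<lambda>n. p k (x n - l)) \<longlonglongrightarrow> 0)" by simp
next
  assume R: "l \<in> E \<and> (\<forall>k. (\<lambda>n. p k (x n - l)) \<longlonglongrightarrow> 0)"
  show "limitin T x l sequentially"
    unfolding limitin_sequentially
  proof (intro conjI allI impI)
    fix U assume "openin T U \<and> l \<in> U"
    then obtain k r where k: "r > 0" "{y \<in> E. p k (y - l) < r} \<subseteq> U"
      by (elim conjE openin_T_ball)
    from LIMSEQ_D[OF conjunct2[OF R, rule_format, of k] k(1)]
    obtain N where N: "\<And>n. n \<ge> N \<Longrightarrow> norm (p k (x n - l) - 0) < r" by blast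
    have "x n \<in> U" if "n \<ge> N" for n
      using k(2) N[OF that] range_subsetD[OF assms, of n] by auto
    then show "\<exists>N. \<forall>n\<ge>N. x n \<in> U" by blast
  qed (use R in simp)
qed

section \<open>Continuity of the algebraic operations\<close>

text \<open>The domain is an arbitrary topological space because it will be a product topology, for
  which no family of seminorms is set up.\<close>

lemma continuous_map_into_T:
  assumes "f \<in> topspace S \<rightarrow> E"
    and "\<And>z k r. z \<in> topspace S \<Longrightarrow> r > 0 \<Longrightarrow>
           \<exists>A. openin S A \<and> z \<in> A \<and> (\<forall>z'\<in>A. p k (f z' - f z) < r)"
  shows "continuous_map S T f"
  unfolding continuous_map_def
proof (intro conjI allI impI)
  show "f \<in> topspace S \<rightarrow> topspace T" using assms(1) by simp
  fix U assume U: "openin T U"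
  show "openin S {z \<in> topspace S. f z \<in> U}"
  proof (subst openin_subopen, intro ballI)
    fix z assume z: "z \<in> {z \<in> topspace S. f z \<in> U}"
    then have "f z \<in> U" by simp
    from openin_T_ball[OF U this]
    obtain k r where k: "r > 0" "{y \<in> E. p k (y - f z) < r} \<subseteq> U" .
    obtain A where A: "openin S A" "z \<in> A" "\<forall>z'\<in>A. p k (f z' - f z) < r"
      using assms(2)[of z r k] z k(1) by blast
    have "A \<subseteq> topspace S" by (rule openin_subset) fact
    then have "A \<subseteq> {z \<in> topspace S. f z \<in> U}" using A k(2) assms(1) by blast
    then show "\<exists>A. openin S A \<and> z \<in> A \<and> A \<subseteq> {z \<in> topspace S. f z \<in> U}" using A by blast
  qed
qed

text \<open>With increments u and v, x'y' - xy = uv + xv + uy. Passing from index k to some m in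
  both factors is harmless, since the neighbourhood may be taken in any seminorm.\<close>

lemma continuous_map_bilinear:
  assumes closed: "\<And>x y. x \<in> E \<Longrightarrow> y \<in> E \<Longrightarrow> mul x y \<in> E"
    and diffL: "\<And>x y z. x \<in> E \<Longrightarrow> y \<in> E \<Longrightarrow> z \<in> E \<Longrightarrow> mul (x - y) z = mul x z - mul y z"
    and diffR: "\<And>x y z. x \<in> E \<Longrightarrow> y \<in> E \<Longrightarrow> z \<in> E \<Longrightarrow> mul x (y - z) = mul x y - mul x z"
    and bound: "\<And>k. \<exists>m C. C > 0 \<and> (\<forall>x\<in>E. \<forall>y\<in>E. p k (mul x y) \<le> C * p m x * p m y)"
  shows "continuous_map (prod_topology T T) T (\<lambda>(x, y). mul x y)"
proof (rule continuous_map_into_T)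
  fix z :: "'v \<times> 'v" and k and r :: real
  assume z: "z \<in> topspace (prod_topology T T)" and r: "r > 0"
  obtain x y where xy: "z = (x, y)" "x \<in> E" "y \<in> E" using z by auto
  obtain m C where m: "C > 0" "\<And>x y. x \<in> E \<Longrightarrow> y \<in> E \<Longrightarrow> p k (mul x y) \<le> C * p m x * p m y"
    using bound[of k] by blast
  define B where "B = C * (1 + p m x + p m y)"
  have B: "B > 0" using m(1) p_nonneg[OF xy(2), of m] p_nonneg[OF xy(3), of m]
    by (simp add: B_def add_pos_nonneg)
  define \<delta> where "\<delta> = min 1 (r / B)"
  have \<delta>: "\<delta> > 0" "\<delta> \<le> 1" "B * \<delta> \<le> r" using r B by (auto simp: \<delta>_def min_def field_simps)
  let ?A = "{x' \<in> E. p m (x' - x) < \<delta>}" and ?B = "{y' \<in> E. p m (y' - y) < \<delta>}"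
  have "p k (mul x' y' - mul x y) < r" if x': "x' \<in> ?A" and y': "y' \<in> ?B" for x' y'
  proof -
    define u v where "u = x' - x" and "v = y' - y"
    have u: "u \<in> E" "p m u < \<delta>" and v: "v \<in> E" "p m v < \<delta>"
      using x' y' xy by (auto simp: u_def v_def intro: E_diff)
    have nn: "0 \<le> p m u" "0 \<le> p m v" "0 \<le> p m x" "0 \<le> p m y"
      using p_nonneg u v xy by auto
    have "mul x' y' - mul x y = (mul u v + mul x v) + mul u y"
      using x' y' xy by (simp add: u_def v_def diffL diffR E_diff)
    then have "p k (mul x' y' - mul x y) \<le> p k (mul u v) + p k (mul x v) + p k (mul u y)"
      using p_triangle[of "mul u v + mul x v" "mul u y" k] p_triangle[of "mul u v" "mul x v" k]
        closed u v xy E_add by fastforce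
    also have "\<dots> \<le> C * p m u * p m v + C * p m x * p m v + C * p m u * p m y"
      using m(2) u v xy by (intro add_mono) auto
    also have "\<dots> = C * (p m u * p m v + p m x * p m v + p m u * p m y)"
      by (simp add: algebra_simps)
    \<comment> \<open>The strict inequality has to come from the term uv, where \<delta> \<le> 1
      gives it; the other two may be equalities, as \<open>p m x\<close> and \<open>p m y\<close>
      can vanish.\<close>
    also have "\<dots> < C * (\<delta> + p m x * \<delta> + \<delta> * p m y)"
    proof (intro mult_strict_left_mono add_less_le_mono m(1))
      have "p m u * p m v \<le> 1 * p m v" using u(2) \<delta>(2) nn by (intro mult_right_mono) auto
      then show "p m u * p m v < \<delta>" using v(2) by simp
    qed (use u v nn in \<open>auto intro: mult_left_mono mult_right_mono\<close>)
    also have "\<dots> = B * \<delta>" by (simp add: B_def algebra_simps)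
    finally show ?thesis using \<delta>(3) by simp
  qed
  then show "\<exists>A. openin (prod_topology T T) A \<and> z \<in> A \<and>
      (\<forall>z'\<in>A. p k ((case z' of (x, y) \<Rightarrow> mul x y) - (case z of (x, y) \<Rightarrow> mul x y)) < r)"
    using xy \<delta>(1) openin_ball[of x m \<delta>] openin_ball[of y m \<delta>]
    by (intro exI[of _ "?A \<times> ?B"]) (auto simp: openin_prod_Times_iff)
qed (use closed in auto)

lemma continuous_map_add: "continuous_map (prod_topology T T) T (\<lambda>(x, y). x + y)"
proof (rule continuous_map_into_T)
  fix z :: "'v \<times> 'v" and k and r :: real
  assume z: "z \<in> topspace (prod_topology T T)" and r: "r > 0"
  obtain x y where xy: "z = (x, y)" "x \<in> E" "y \<in> E" using z by auto
  let ?A = "{x' \<in> E. p k (x' - x) < r / 2}" and ?B = "{y' \<in> E. p k (y' - y) < r / 2}"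
  have "p k (x' + y' - (x + y)) < r" if "x' \<in> ?A" "y' \<in> ?B" for x' y'
    using that p_triangle[of "x' - x" "y' - y" k] xy by (auto simp: E_diff algebra_simps)
  then show "\<exists>A. openin (prod_topology T T) A \<and> z \<in> A \<and>
      (\<forall>z'\<in>A. p k ((case z' of (x, y) \<Rightarrow> x + y) - (case z of (x, y) \<Rightarrow> x + y)) < r)"
    using xy r openin_ball[of x k "r / 2"] openin_ball[of y k "r / 2"]
    by (intro exI[of _ "?A \<times> ?B"]) (auto simp: openin_prod_Times_iff)
qed (auto simp: E_add)

text \<open>One factor carries the euclidean topology, so the bilinear criterion does not apply. The
  increment is split as c'u + (c' - c)x, with |c'| \<le> 1 + |c| because \<delta> \<le> 1.\<close>

lemma continuous_map_scale: "continuous_map (prod_topology euclidean T) T (\<lambda>(c, x). scale c x)"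
proof (rule continuous_map_into_T)
  fix z :: "complex \<times> 'v" and k and r :: real
  assume z: "z \<in> topspace (prod_topology euclidean T)" and r: "r > 0"
  obtain c x where cx: "z = (c, x)" "x \<in> E" using z by auto
  define B where "B = 1 + cmod c + p k x"
  have B: "B > 0" using p_nonneg[OF cx(2), of k] by (simp add: B_def add_pos_nonneg)
  define \<delta> where "\<delta> = min 1 (r / B)"
  have \<delta>: "\<delta> > 0" "\<delta> \<le> 1" "B * \<delta> \<le> r" using r B by (auto simp: \<delta>_def min_def field_simps)
  let ?A = "ball c \<delta>" and ?B = "{x' \<in> E. p k (x' - x) < \<delta>}"
  have "p k (scale c' x' - scale c x) < r" if c': "c' \<in> ?A" and x': "x' \<in> ?B" for c' x'
  proof -
    define u where "u = x' - x"
    have u: "u \<in> E" "p k u < \<delta>" using x' cx by (auto simp: u_def intro: E_diff)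
    have c: "cmod (c' - c) < \<delta>" using c' by (simp add: dist_norm norm_minus_commute)
    have nn: "0 \<le> p k u" "0 \<le> p k x" using p_nonneg u cx by auto
    have "scale c' x' - scale c x = scale c' u + scale (c' - c) x"
      by (simp add: u_def scale_right_diff_distrib scale_left_diff_distrib)
    then have "p k (scale c' x' - scale c x) \<le> cmod c' * p k u + cmod (c' - c) * p k x"
      using p_triangle[of "scale c' u" "scale (c' - c) x" k] u cx by (simp add: E_scale p_scale)
    also have "\<dots> < (1 + cmod c) * \<delta> + \<delta> * p k x"
    proof (rule add_less_le_mono)
      have "cmod c' \<le> cmod c + cmod (c' - c)" by (metis norm_triangle_sub)
      then have "cmod c' \<le> 1 + cmod c" using c \<delta>(2) by linarith
      then have "cmod c' * p k u \<le> (1 + cmod c) * p k u" using nn by (intro mult_right_mono) auto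
      also have "\<dots> < (1 + cmod c) * \<delta>" using u by (simp add: add_pos_nonneg)
      finally show "cmod c' * p k u < (1 + cmod c) * \<delta>" .
    qed (use c nn in \<open>auto intro: mult_right_mono\<close>)
    also have "\<dots> = B * \<delta>" by (simp add: B_def algebra_simps)
    finally show ?thesis using \<delta>(3) by simp
  qed
  then show "\<exists>A. openin (prod_topology euclidean T) A \<and> z \<in> A \<and>
      (\<forall>z'\<in>A. p k ((case z' of (c, x) \<Rightarrow> scale c x) - (case z of (c, x) \<Rightarrow> scale c x)) < r)"
    using cx \<delta>(1) openin_ball[of x k \<delta>]
    by (intro exI[of _ "?A \<times> ?B"]) (auto simp: openin_prod_Times_iff)
qed (auto simp: E_scale)

section \<open>Local convexity and metrizability\<close>

lemma locally_convex: "locally_convex_space scale T"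
  unfolding locally_convex_space_def tvs_def
proof (intro conjI allI impI)
  fix U assume U: "nbhd_zero T U"
  then obtain k r where k: "r > 0" "{y \<in> E. p k y < r} \<subseteq> U" by (elim conjE nbhd_zero_ballE)
  let ?V = "{y \<in> E. p k y < r}"
  have "convex_set scale ?V"
    unfolding convex_set_def
  proof (intro ballI allI impI)
    fix x y and t :: real
    assume x: "x \<in> ?V" and y: "y \<in> ?V" and t: "0 \<le> t \<and> t \<le> 1"
    have "p k (scale (of_real t) x + scale (of_real (1 - t)) y)
          \<le> cmod (of_real t) * p k x + cmod (of_real (1 - t)) * p k y"
      using p_triangle[of "scale (of_real t) x" "scale (of_real (1 - t)) y" k] x y
      by (simp add: E_scale p_scale del: of_real_diff)
    also have "\<dots> = t * p k x + (1 - t) * p k y"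
      using t by (simp add: norm_of_real del: of_real_diff)
    also have "\<dots> < r" by (rule convex_bound_lt) (use x y t in auto)
    finally show "scale (of_real t) x + scale (of_real (1 - t)) y \<in> ?V"
      using x y by (simp add: E_add E_scale)
  qed
  then show "\<exists>V. nbhd_zero T V \<and> convex_set scale V \<and> V \<subseteq> U"
    using k nbhd_zero_ball by blast
qed (use subspace_E vector_space_axioms continuous_map_add continuous_map_scale in auto)

text \<open>The metric is \<open>SUP k. min (1 / (k + 1)) (p k (x - y))\<close>; outside \<open>E\<close> it is set to \<open>0\<close>
  because \<open>Metric_space\<close> requires nonnegativity and symmetry everywhere.\<close>

lemma metrizable: "metrizable_space T"
proof -
  define f where "f = (\<lambda>x k. min (1 / real (Suc k)) (p k x))"
  define d where "d = (\<lambda>x y. if x \<in> E \<and> y \<in> E then (SUP k. f (x - y) k) else 0)"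
  have bdd: "bdd_above (range (f x))" for x
    by (rule bdd_aboveI[of _ 1]) (auto simp: f_def min_le_iff_disj)
  have f_le: "f (x - y) k \<le> d x y" if "x \<in> E" "y \<in> E" for x y k
    using that by (simp add: d_def cSUP_upper[OF _ bdd])
  have d_leI: "d x y \<le> r" if "x \<in> E" "y \<in> E" "\<And>k. f (x - y) k \<le> r" for x y r
    using that by (simp add: d_def cSUP_least)
  have f_nonneg: "0 \<le> f x k" if "x \<in> E" for x k
    using that p_nonneg by (simp add: f_def)
  have d_nonneg: "0 \<le> d x y" for x y
    using f_le[of x y 0] f_nonneg[of "x - y" 0] E_diff[of x y] by (fastforce simp: d_def)
  interpret M: Metric_space E d
  proof
    fix x y z
    show "0 \<le> d x y" by (rule d_nonneg)
    show "d x y = d y x" by (auto simp: d_def f_def p_minus_commute)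
    show "d x y = 0 \<longleftrightarrow> x = y" if xy: "x \<in> E" "y \<in> E"
    proof
      assume "d x y = 0"
      \<comment> \<open>The cap at index 0 equals 1, so a nonpositive minimum forces the seminorm
        itself to vanish.\<close>
      then have "f (x - y) 0 \<le> 0" using f_le[OF xy, of 0] by simp
      then have "p 0 (x - y) = 0"
        using p_nonneg[OF E_diff[OF xy], of 0] by (simp add: f_def min_le_iff_disj)
      then show "x = y" using p_definite[OF E_diff[OF xy]] by simp
    qed (use xy d_nonneg[of x y] d_leI[of x y 0] in \<open>auto simp: f_def intro: antisym\<close>)
    show "d x z \<le> d x y + d y z" if xyz: "x \<in> E" "y \<in> E" "z \<in> E"
    proof (rule d_leI)
      fix k
      have "f (x - z) k \<le> f (x - y) k + f (y - z) k"
        using p_triangle3[OF xyz, of k] p_nonneg[OF E_diff[OF xyz(1,2)], of k]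
          p_nonneg[OF E_diff[OF xyz(2,3)], of k]
        unfolding f_def by (smt (verit) divide_nonneg_nonneg of_nat_0_le_iff)
      also have "\<dots> \<le> d x y + d y z" using f_le xyz by (intro add_mono) auto
      finally show "f (x - z) k \<le> d x y + d y z" .
    qed (use xyz in auto)
  qed
  have "openin T U \<longleftrightarrow> openin M.mtopology U" for U
    unfolding openin_T_iff M.openin_mtopology
  proof (intro conj_cong refl iffI allI impI ballI)
    fix x assume UE: "U \<subseteq> E" and x: "x \<in> U"
    { assume "\<forall>x\<in>U. \<exists>k r. r > 0 \<and> {y \<in> E. p k (y - x) < r} \<subseteq> U"
      then obtain k r where k: "r > 0" "{y \<in> E. p k (y - x) < r} \<subseteq> U" using x by blast
      have "p k (y - x) < r" if y: "x \<in> E" "y \<in> E" "d x y < min (1 / real (Suc k)) r" for y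
        using f_le[OF y(1,2), of k] p_minus_commute[OF y(1,2), of k] y(3) by (auto simp: f_def min_def split: if_splits)
      then have "M.mball x (min (1 / real (Suc k)) r) \<subseteq> U" using k(2) by (auto simp: M.mball_def)
      then show "\<exists>r>0. M.mball x r \<subseteq> U"
        using k(1) by (intro exI[of _ "min (1 / real (Suc k)) r"]) auto }
    { assume "\<forall>x. x \<in> U \<longrightarrow> (\<exists>r>0. M.mball x r \<subseteq> U)"
      then obtain r where r: "r > 0" "M.mball x r \<subseteq> U" using x by blast
      \<comment> \<open>Indices beyond K are controlled by their cap, those up to K by
        \<open>p K\<close> through monotonicity. The half makes room for the supremum, which
        preserves only the weak inequality.\<close>
      obtain K where K: "1 / real (Suc K) < r / 2"
        using reals_Archimedean[of "r / 2"] r(1) by (auto simp: inverse_eq_divide)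
      have "y \<in> M.mball x r" if y: "y \<in> E" "p K (y - x) < r / 2" for y
      proof -
        have xE: "x \<in> E" using UE x by blast
        have "f (x - y) k \<le> r / 2" for k
        proof (cases "k \<le> K")
          case True
          then show ?thesis
            using p_mono[OF E_diff[OF xE y(1)] True] y p_minus_commute[OF xE y(1), of K]
            by (auto simp: f_def min_def)
        next
          case False
          then have "1 / real (Suc k) \<le> 1 / real (Suc K)" by (simp add: field_simps)
          then show ?thesis using K by (auto simp: f_def min_def)
        qed
        then have "d x y \<le> r / 2" using xE y d_leI by blast
        then show ?thesis using xE y r(1) by (simp add: M.mball_def)
      qed
      then show "\<exists>k r. r > 0 \<and> {y \<in> E. p k (y - x) < r} \<subseteq> U"
        using r by (intro exI[of _ K] exI[of _ "r / 2"]) auto }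
  qed
  then have "T = M.mtopology" by (simp add: topology_eq)
  then show ?thesis using M.metrizable_space_mtopology by simp
qed

section \<open>Criteria for completeness and the Schwartz property\<close>

lemma frechet_spaceI:
  assumes complete: "\<And>x. range x \<subseteq> E \<Longrightarrow>
      (\<And>k e. e > 0 \<Longrightarrow> \<exists>N. \<forall>m\<ge>N. \<forall>n\<ge>N. p k (x m - x n) < e) \<Longrightarrow>
      \<exists>l\<in>E. \<forall>k. (\<lambda>n. p k (x n - l)) \<longlonglongrightarrow> 0"
  shows "frechet_space scale T"
  unfolding frechet_space_def
proof (intro conjI allI impI)
  fix x assume x: "tvs_Cauchy T x"
  then have xE: "range x \<subseteq> E" by (simp add: tvs_Cauchy_def)
  have "\<exists>N. \<forall>m\<ge>N. \<forall>n\<ge>N. p k (x m - x n) < e" if "e > 0" for k e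
    using x nbhd_zero_ball[OF that, of k] unfolding tvs_Cauchy_def by blast
  then show "\<exists>l. limitin T x l sequentially"
    using complete[OF xE] limitin_T_iff[OF xE] by blast
qed (use locally_convex metrizable in auto)

text \<open>The index m is chosen before \<epsilon>, so one unit ball serves as V for all
  \<epsilon>; the nets must consist of points of that ball because the definition asks for
  \<open>F \<subseteq> V\<close>.\<close>

lemma schwartz_spaceI:
  assumes "\<And>k. \<exists>m. \<forall>\<epsilon>>0. \<exists>F. finite F \<and> F \<subseteq> {x \<in> E. p m x < 1} \<and>
      (\<forall>y\<in>E. p m y < 1 \<longrightarrow> (\<exists>x\<in>F. p k (y - x) < \<epsilon>))"
  shows "schwartz_space scale T"
  unfolding schwartz_space_def
proof (intro conjI allI impI)
  fix U assume "nbhd_zero T U \<and> absolutely_convex_set scale U"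
  then obtain k r where k: "r > 0" "{y \<in> E. p k y < r} \<subseteq> U" by (elim conjE nbhd_zero_ballE)
  obtain m where m: "\<And>\<epsilon>. \<epsilon> > 0 \<Longrightarrow> \<exists>F. finite F \<and> F \<subseteq> {x \<in> E. p m x < 1} \<and>
      (\<forall>y\<in>E. p m y < 1 \<longrightarrow> (\<exists>x\<in>F. p k (y - x) < \<epsilon>))"
    using assms[of k] by blast
  let ?V = "{x \<in> E. p m x < 1}"
  have "\<exists>F. finite F \<and> F \<subseteq> ?V \<and> ?V \<subseteq> (\<Union>x\<in>F. (\<lambda>u. x + scale (of_real \<epsilon>) u) ` U)"
    if \<epsilon>: "\<epsilon> > 0" for \<epsilon> :: real
  proof -
    \<comment> \<open>The mesh is \<epsilon> r because y - x, after division by \<epsilon>, has to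
      land in the r-ball contained in U.\<close>
    obtain F where F: "finite F" "F \<subseteq> ?V"
        "\<And>y. y \<in> E \<Longrightarrow> p m y < 1 \<Longrightarrow> \<exists>x\<in>F. p k (y - x) < \<epsilon> * r"
      using m[of "\<epsilon> * r"] \<epsilon> k(1) by auto
    have "y \<in> (\<Union>x\<in>F. (\<lambda>u. x + scale (of_real \<epsilon>) u) ` U)" if y: "y \<in> ?V" for y
    proof -
      obtain x where x: "x \<in> F" "p k (y - x) < \<epsilon> * r" using F(3) y by blast
      define u where "u = scale (of_real (1 / \<epsilon>)) (y - x)"
      have xy: "y - x \<in> E" using x F(2) y E_diff by blast
      have "p k u = p k (y - x) / \<epsilon>"
        using \<epsilon> by (simp add: u_def p_scale[OF xy] norm_divide)
      also have "\<dots> < r" using x(2) \<epsilon> by (simp add: field_simps)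
      finally have "u \<in> U" using k(2) xy by (auto simp: u_def E_scale)
      moreover have "y = x + scale (of_real \<epsilon>) u" using \<epsilon> by (simp add: u_def)
      ultimately show ?thesis using x(1) by blast
    qed
    then show ?thesis using F by blast
  qed
  then show "\<exists>V. nbhd_zero T V \<and> (\<forall>\<epsilon>::real. \<epsilon> > 0 \<longrightarrow>
      (\<exists>F. finite F \<and> F \<subseteq> V \<and> V \<subseteq> (\<Union>x\<in>F. (\<lambda>u. x + scale (of_real \<epsilon>) u) ` U)))"
    using nbhd_zero_ball[of 1 m] by (intro exI[of _ ?V]) simp
qed (rule locally_convex)

section \<open>Continuous seminorms\<close>

lemma continuous_seminorm_p: "continuous_seminorm scale T (p k)"
  unfolding continuous_seminorm_def
proof (intro conjI)
  show "continuous_map T euclideanreal (p k)"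
    unfolding continuous_map_def
  proof (intro conjI allI impI)
    fix U :: "real set" assume "openin euclideanreal U"
    then have U: "open U" by simp
    show "openin T {x \<in> topspace T. p k x \<in> U}"
      unfolding openin_T_iff
    proof (intro conjI ballI)
      fix x assume x: "x \<in> {x \<in> topspace T. p k x \<in> U}"
      then obtain e where e: "e > 0" "\<And>t. \<bar>t - p k x\<bar> < e \<Longrightarrow> t \<in> U"
        using U unfolding open_real by blast
      have "p k y \<in> U" if "y \<in> E" "p k (y - x) < e" for y
        using e(2)[of "p k y"] p_reverse_triangle[of y x k] that x by simp
      then show "\<exists>m r. r > 0 \<and> {y \<in> E. p m (y - x) < r} \<subseteq> {x \<in> topspace T. p k x \<in> U}"
        using e(1) by (intro exI[of _ k] exI[of _ e]) auto
    qed simp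
  qed simp
qed (auto simp: p_nonneg p_triangle p_scale)

lemma continuous_seminorm_bound:
  assumes q: "continuous_seminorm scale T q"
  shows "\<exists>k C. C > 0 \<and> (\<forall>x\<in>E. q x \<le> C * p k x)"
proof -
  have q_scale: "q (scale c x) = cmod c * q x" if "x \<in> E" for c x
    using q that by (simp add: continuous_seminorm_def)
  have W: "openin T {x \<in> topspace T. q x \<in> {..<1}}"
    using q by (intro openin_continuous_map_preimage[of _ euclideanreal]) (auto simp: continuous_seminorm_def)
  have "q 0 = 0" using q_scale[of 0 0] by simp
  then have "0 \<in> {x \<in> topspace T. q x \<in> {..<1}}" by simp
  from openin_T_ball[OF W this]
  obtain k r where k: "r > 0" "{y \<in> E. p k (y - 0) < r} \<subseteq> {x \<in> topspace T. q x \<in> {..<1}}" .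
  then have k2: "q y < 1" if "y \<in> E" "p k y < r" for y
    using that by auto
  have "q x \<le> 2 / r * p k x" if x: "x \<in> E" for x
  proof (rule field_le_epsilon)
    fix e :: real assume e: "e > 0"
    \<comment> \<open>The summand e keeps t positive when \<open>p k x = 0\<close>, so that x can be
      scaled by 1/t into the r-ball in every case.\<close>
    define t where "t = 2 / r * p k x + e"
    have t: "t > 0" using k(1) e p_nonneg[OF x, of k] by (simp add: t_def add_nonneg_pos)
    have "p k x < t * r" using k(1) e p_nonneg[OF x, of k] by (simp add: t_def field_simps add_pos_nonneg)
    then have "p k (scale (of_real (1 / t)) x) < r"
      using t by (simp add: p_scale[OF x] norm_divide field_simps)
    then have "q (scale (of_real (1 / t)) x) < 1" using k2 x E_scale by blast
    then have "q x < t" using t by (simp add: q_scale[OF x] norm_divide field_simps)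
    then show "q x \<le> 2 / r * p k x + e" by (simp add: t_def)
  qed
  then show ?thesis using k(1) by (intro exI[of _ k] exI[of _ "2 / r"]) auto
qed

section \<open>Representatives of elements of local Banach spaces\<close>

text \<open>\<open>local_norm\<close> is a bare \<open>lim\<close>, which carries information only
  once convergence is known. The reverse triangle inequality makes the norms a Cauchy sequence of
  reals.\<close>

lemma local_Cauchy_convergent:
  assumes "local_Cauchy T (p m) u"
  shows "(\<lambda>k. p m (u k)) \<longlonglongrightarrow> local_norm (p m) u"
proof -
  have "Cauchy (\<lambda>k. p m (u k))"
  proof (rule CauchyI)
    fix e :: real assume "e > 0"
    then obtain N where "\<forall>k\<ge>N. \<forall>l\<ge>N. p m (u k - u l) < e"
      using assms unfolding local_Cauchy_def by blast
    moreover have "range u \<subseteq> E" using assms by (simp add: local_Cauchy_def)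
    ultimately show "\<exists>N. \<forall>k\<ge>N. \<forall>l\<ge>N. norm (p m (u k) - p m (u l)) < e"
      using p_reverse_triangle by (metis le_less_trans range_subsetD real_norm_def)
  qed
  then show ?thesis
    by (simp add: local_norm_def Cauchy_convergent_iff convergent_LIMSEQ_iff)
qed

lemma local_Cauchy_const: "x \<in> E \<Longrightarrow> local_Cauchy T (p m) (\<lambda>_. x)"
  by (auto simp: local_Cauchy_def)

lemma local_Cauchy_diff_scale:
  assumes u: "local_Cauchy T (p m) u" and v: "local_Cauchy T (p m) v"
  shows "local_Cauchy T (p m) (\<lambda>k. u k - scale c (v k))"
  unfolding local_Cauchy_def
proof (intro conjI allI impI)
  have uE: "u k \<in> E" and vE: "v k \<in> E" for k
    using u v by (auto simp: local_Cauchy_def)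
  then show "range (\<lambda>k. u k - scale c (v k)) \<subseteq> topspace T" by (auto simp: E_diff E_scale)
  fix e :: real assume e: "e > 0"
  \<comment> \<open>The summand 1 keeps the divisor positive when c = 0.\<close>
  define e' where "e' = e / 2 / (1 + cmod c)"
  have pos: "1 + cmod c > 0" by (simp add: add_pos_nonneg)
  then have e': "e' > 0" "(1 + cmod c) * e' = e / 2" using e by (auto simp: e'_def field_simps)
  obtain M where M: "\<forall>k\<ge>M. \<forall>l\<ge>M. p m (u k - u l) < e / 2"
    using u e unfolding local_Cauchy_def by (meson half_gt_zero)
  obtain N where N: "\<forall>k\<ge>N. \<forall>l\<ge>N. p m (v k - v l) < e'"
    using v e' unfolding local_Cauchy_def by meson
  have "p m ((u k - scale c (v k)) - (u l - scale c (v l))) < e"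
    if kl: "k \<ge> max M N" "l \<ge> max M N" for k l
  proof -
    have vv: "v k - v l \<in> E" using vE E_diff by blast
    have "(u k - scale c (v k)) - (u l - scale c (v l)) = (u k - u l) + scale (- c) (v k - v l)"
      by (simp add: scale_right_diff_distrib)
    then have "p m ((u k - scale c (v k)) - (u l - scale c (v l)))
               = p m ((u k - u l) + scale (- c) (v k - v l))"
      by (rule arg_cong)
    also have "\<dots> \<le> p m (u k - u l) + cmod c * p m (v k - v l)"
      using p_triangle[of "u k - u l" "scale (- c) (v k - v l)" m] uE vv
      by (simp add: E_diff E_scale p_scale del: scale_minus_left)
    finally have "p m ((u k - scale c (v k)) - (u l - scale c (v l)))
               \<le> p m (u k - u l) + cmod c * p m (v k - v l)" .
    moreover have "cmod c * p m (v k - v l) \<le> (1 + cmod c) * p m (v k - v l)"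
      using p_nonneg[OF vv] by (intro mult_right_mono) auto
    moreover have "(1 + cmod c) * p m (v k - v l) < (1 + cmod c) * e'"
      using N kl pos by auto
    moreover have "p m (u k - u l) < e / 2" using M kl by auto
    ultimately show ?thesis using e'(2) by linarith
  qed
  then show "\<exists>N. \<forall>k\<ge>N. \<forall>l\<ge>N. p m ((u k - scale c (v k)) - (u l - scale c (v l))) < e" by blast
qed

text \<open>Makes the remainder of a nuclear expansion a legitimate representative, so that its
  local norm is a genuine limit.\<close>

lemma local_Cauchy_diff_sum:
  assumes "x \<in> E" and u: "\<And>j. local_Cauchy T (p m) (u j)"
  shows "local_Cauchy T (p m) (\<lambda>k. x - (\<Sum>j<(N::nat). scale (y j) (u j k)))"
proof (induction N)
  case 0
  then show ?case using local_Cauchy_const assms(1) by simp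
next
  case (Suc N)
  then show ?case
    using local_Cauchy_diff_scale[OF Suc.IH u[of N], of "y N"] by (simp add: diff_diff_eq)
qed

end

section \<open>Weighted square-summable sequences\<close>

lemma H2_L2_set_le:
  assumes "a \<in> H2" "finite S"
  shows "L2_set (\<lambda>n. cmod (a n)) S \<le> H2_norm a"
  unfolding L2_set_def H2_norm_def
  using assms by (intro real_sqrt_le_mono sum_le_suminf) (auto simp: H2_def)

text \<open>Bounds on all finite sections give membership and the norm estimate together, so the l^2
  inequalities below reduce to those for \<open>L2_set\<close>.\<close>

lemma H2_I:
  assumes "a 0 = 0" and B: "\<And>M. L2_set (\<lambda>n. cmod (a n)) {..<M} \<le> B"
  shows "a \<in> H2" and "H2_norm a \<le> B"
proof -
  have B0: "B \<ge> 0" using B[of 0] by simp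
  have le: "(\<Sum>n<M. (cmod (a n))\<^sup>2) \<le> B\<^sup>2" for M
    using B[of M] B0 by (simp add: L2_set_def real_sqrt_le_iff sqrt_le_D)
  have s: "summable (\<lambda>n. (cmod (a n))\<^sup>2)"
    by (rule summableI_nonneg_bounded[OF _ le]) simp
  then show "a \<in> H2" using assms(1) by (simp add: H2_def)
  have "(\<Sum>n. (cmod (a n))\<^sup>2) \<le> B\<^sup>2" by (rule suminf_le_const[OF s le])
  then show "H2_norm a \<le> B" unfolding H2_norm_def using B0 by (intro real_le_lsqrt)
qed

lemma H2_norm_nonneg: "a \<in> H2 \<Longrightarrow> 0 \<le> H2_norm a"
  using H2_L2_set_le[of a "{}"] by simp

lemma H2_coord_le: "a \<in> H2 \<Longrightarrow> cmod (a n) \<le> H2_norm a"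
  using H2_L2_set_le[of a "{n}"] by (simp add: L2_set_def)

lemma H2_dominated:
  assumes "b \<in> H2" "C \<ge> 0" "\<And>n. cmod (a n) \<le> C * cmod (b n)"
  shows "a \<in> H2" and "H2_norm a \<le> C * H2_norm b"
proof -
  have 0: "a 0 = 0" using assms(3)[of 0] assms(1) by (simp add: H2_def)
  have "L2_set (\<lambda>n. cmod (a n)) {..<M} \<le> C * H2_norm b" for M
  proof -
    have "L2_set (\<lambda>n. cmod (a n)) {..<M} \<le> L2_set (\<lambda>n. C * cmod (b n)) {..<M}"
      using assms by (intro L2_set_mono) auto
    also have "\<dots> = C * L2_set (\<lambda>n. cmod (b n)) {..<M}"
      using assms(2) by (simp add: L2_set_right_distrib)
    also have "\<dots> \<le> C * H2_norm b"
      using assms by (intro mult_left_mono H2_L2_set_le) auto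
    finally show ?thesis .
  qed
  from H2_I[of a, OF 0 this] show "a \<in> H2" "H2_norm a \<le> C * H2_norm b" .
qed

lemma H2_add:
  assumes "a \<in> H2" "b \<in> H2"
  shows "a + b \<in> H2" and "H2_norm (a + b) \<le> H2_norm a + H2_norm b"
proof -
  have 0: "(a + b) 0 = 0" using assms by (simp add: H2_def)
  have "L2_set (\<lambda>n. cmod ((a + b) n)) {..<M} \<le> H2_norm a + H2_norm b" for M
  proof -
    have "L2_set (\<lambda>n. cmod ((a + b) n)) {..<M} \<le> L2_set (\<lambda>n. cmod (a n) + cmod (b n)) {..<M}"
      by (intro L2_set_mono) (auto intro: norm_triangle_ineq)
    also have "\<dots> \<le> L2_set (\<lambda>n. cmod (a n)) {..<M} + L2_set (\<lambda>n. cmod (b n)) {..<M}"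
      by (rule L2_set_triangle_ineq)
    also have "\<dots> \<le> H2_norm a + H2_norm b"
      using assms by (intro add_mono H2_L2_set_le) auto
    finally show ?thesis .
  qed
  from H2_I[of "a + b", OF 0 this] show "a + b \<in> H2" "H2_norm (a + b) \<le> H2_norm a + H2_norm b" .
qed

lemma H2_scale:
  assumes "a \<in> H2"
  shows "dirichlet_scale c a \<in> H2" and "H2_norm (dirichlet_scale c a) = cmod c * H2_norm a"
proof -
  have s: "summable (\<lambda>n. (cmod (a n))\<^sup>2)" using assms by (simp add: H2_def)
  then show "dirichlet_scale c a \<in> H2"
    using assms by (simp add: H2_def dirichlet_scale_def norm_mult power_mult_distrib summable_mult)
  show "H2_norm (dirichlet_scale c a) = cmod c * H2_norm a"
    using suminf_mult[OF s, of "(cmod c)\<^sup>2"]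
    by (simp add: H2_norm_def dirichlet_scale_def norm_mult power_mult_distrib real_sqrt_mult)
qed

lemma H2_diff:
  assumes "a \<in> H2" "b \<in> H2"
  shows "a - b \<in> H2"
proof -
  have "a - b = a + dirichlet_scale (-1) b" by (simp add: dirichlet_scale_def fun_eq_iff)
  then show ?thesis using H2_add(1)[OF assms(1) H2_scale(1)[OF assms(2)], of "-1"] by (simp only:)
qed

text \<open>The completeness argument for l^2: the Cauchy estimate survives the limit on each finite
  section, and the bounds on the sections are then reassembled.\<close>

lemma H2_pointwise_limit:
  assumes x: "\<And>m. x m \<in> H2"
    and cauchy: "\<And>e. e > 0 \<Longrightarrow> \<exists>N. \<forall>m\<ge>N. \<forall>n\<ge>N. H2_norm (x m - x n) < e"
    and lim: "\<And>i. (\<lambda>n. x n i) \<longlonglongrightarrow> l i"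
  shows "l \<in> H2" and "(\<lambda>n. H2_norm (x n - l)) \<longlonglongrightarrow> 0"
proof -
  have "(\<lambda>n. x n 0) \<longlonglongrightarrow> 0" using x by (simp add: H2_def)
  then have l0: "l 0 = 0" using lim[of 0] LIMSEQ_unique by blast
  have close: "\<exists>N. \<forall>m\<ge>N. x m - l \<in> H2 \<and> H2_norm (x m - l) \<le> e" if e: "e > 0" for e
  proof -
    obtain N where N: "\<forall>m\<ge>N. \<forall>n\<ge>N. H2_norm (x m - x n) < e" using cauchy[OF e] by blast
    \<comment> \<open>Here m and M stay fixed while n tends to infinity; only finitely many
      coordinates are involved, so pointwise convergence is enough.\<close>
    have "L2_set (\<lambda>i. cmod ((x m - l) i)) {..<M} \<le> e" if m: "m \<ge> N" for m M
    proof (rule LIMSEQ_le_const2)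
      show "(\<lambda>n. L2_set (\<lambda>i. cmod ((x m - x n) i)) {..<M}) \<longlonglongrightarrow> L2_set (\<lambda>i. cmod ((x m - l) i)) {..<M}"
        unfolding L2_set_def minus_apply by (intro tendsto_intros lim)
      have "L2_set (\<lambda>i. cmod ((x m - x n) i)) {..<M} \<le> e" if "n \<ge> N" for n
        using H2_L2_set_le[OF H2_diff[OF x x], of "{..<M}" m n] N m that by fastforce
      then show "\<exists>N. \<forall>n\<ge>N. L2_set (\<lambda>i. cmod ((x m - x n) i)) {..<M} \<le> e" by blast
    qed
    moreover have "(x m - l) 0 = 0" for m using x[of m] l0 by (simp add: H2_def)
    ultimately have "\<forall>m\<ge>N. x m - l \<in> H2 \<and> H2_norm (x m - l) \<le> e" using H2_I by blast
    then show ?thesis by blast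
  qed
  then obtain N where N: "x N - l \<in> H2" using zero_less_one by blast
  \<comment> \<open>l = x N - (x N - l), a difference of two elements of the space.\<close>
  then show "l \<in> H2" using H2_diff[OF x[of N] N] by simp
  then have *: "x n - l \<in> H2" for n using x H2_diff by blast
  show "(\<lambda>n. H2_norm (x n - l)) \<longlonglongrightarrow> 0"
  proof (rule LIMSEQ_I)
    fix r :: real assume "r > 0"
    then obtain N where "\<forall>m\<ge>N. H2_norm (x m - l) \<le> r / 2" using close[of "r / 2"] by auto
    then show "\<exists>N. \<forall>n\<ge>N. norm (H2_norm (x n - l) - 0) < r"
      using H2_norm_nonneg[OF *] \<open>r > 0\<close> by (intro exI[of _ N]) fastforce
  qed
qed

text \<open>The sets are neither nested nor intervals a priori, which is what permuted expansions
  require. Eventually they contain any given initial segment, and nonnegativity squeezes the sums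
  over them between a partial sum and the total.\<close>

lemma H2_tail_tendsto_zero:
  assumes a: "a \<in> H2" and fin: "\<And>N. finite (S N)" and ev: "\<And>n. eventually (\<lambda>N. n \<in> S N) sequentially"
  shows "(\<lambda>N. H2_norm (\<lambda>n. if n \<in> S N then 0 else a n)) \<longlonglongrightarrow> 0"
proof -
  define f where "f = (\<lambda>n. (cmod (a n))\<^sup>2)"
  have f: "summable f" using a by (simp add: f_def H2_def)
  have eq: "(\<Sum>n. (cmod (if n \<in> S N then 0 else a n))\<^sup>2) = suminf f - sum f (S N)" for N
  proof -
    have "(\<lambda>n. f n - (if n \<in> S N then f n else 0)) sums (suminf f - sum f (S N))"
      by (intro sums_diff summable_sums f sums_If_finite_set fin)
    also have "(\<lambda>n. f n - (if n \<in> S N then f n else 0)) = (\<lambda>n. (cmod (if n \<in> S N then 0 else a n))\<^sup>2)"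
      by (auto simp: f_def)
    finally show ?thesis by (simp add: sums_iff)
  qed
  have "(\<lambda>N. sum f (S N)) \<longlonglongrightarrow> suminf f"
  proof (rule LIMSEQ_I)
    fix r :: real assume "r > 0"
    then obtain M where M: "norm (sum f {..<M} - suminf f) < r"
      using summable_LIMSEQ[OF f] LIMSEQ_D by blast
    have "eventually (\<lambda>N. \<forall>n\<in>{..<M}. n \<in> S N) sequentially"
      by (intro eventually_ball_finite ballI ev) simp
    then obtain N0 where N0: "\<forall>N\<ge>N0. {..<M} \<subseteq> S N"
      unfolding eventually_sequentially by blast
    have "norm (sum f (S N) - suminf f) < r" if "N \<ge> N0" for N
    proof -
      have "sum f {..<M} \<le> sum f (S N)"
        using N0 that by (intro sum_mono2 fin) (auto simp: f_def)
      moreover have "sum f (S N) \<le> suminf f"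
        by (intro sum_le_suminf f fin) (auto simp: f_def)
      ultimately show ?thesis using M by auto
    qed
    then show "\<exists>N0. \<forall>N\<ge>N0. norm (sum f (S N) - suminf f) < r" by blast
  qed
  then have "(\<lambda>N. sqrt (suminf f - sum f (S N))) \<longlonglongrightarrow> sqrt (suminf f - suminf f)"
    by (intro tendsto_intros)
  then show ?thesis by (simp add: H2_norm_def eq)
qed

section \<open>Weighted norms as norms of translated series\<close>

text \<open>These are the coefficients of the horizontal translate D(s + t). At index 0 the divisor
  is 0, so the value is 0 whatever \<open>a 0\<close> is.\<close>

definition twist :: "real \<Rightarrow> (nat \<Rightarrow> complex) \<Rightarrow> nat \<Rightarrow> complex" where
  "twist t a = (\<lambda>n. a n / of_real (real n powr t))"

lemma H_plus_seminorm_twist: "H_plus_seminorm k a = H2_norm (twist (1 / real k) a)"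
  by (simp add: H_plus_seminorm_def twist_def)

lemma twist_add: "twist t (a + b) = twist t a + twist t b"
  and twist_diff: "twist t (a - b) = twist t a - twist t b"
  and twist_scale: "twist t (dirichlet_scale c a) = dirichlet_scale c (twist t a)"
  by (auto simp: twist_def dirichlet_scale_def add_divide_distrib diff_divide_distrib)

lemma twist_zero [simp]: "twist t a 0 = 0"
  by (simp add: twist_def)

lemma cmod_twist: "cmod (twist t a n) = cmod (a n) * real n powr (- t)"
  by (simp add: twist_def norm_divide powr_minus divide_inverse norm_mult norm_inverse)

lemma cmod_twist_antimono:
  assumes "s \<le> t"
  shows "cmod (twist t a n) \<le> cmod (twist s a n)"
  using assms by (cases "n = 0") (auto simp: cmod_twist intro!: mult_left_mono powr_mono)

lemma twist_H2_mono:
  assumes "s \<le> t" "twist s a \<in> H2"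
  shows "twist t a \<in> H2" and "H2_norm (twist t a) \<le> H2_norm (twist s a)"
  using H2_dominated[of "twist s a" 1 "twist t a"] cmod_twist_antimono[OF assms(1)] assms(2) by auto

text \<open>A smaller exponent gives a stronger condition, and the numbers 1/(k+1) come arbitrarily
  close to 0.\<close>

lemma H_plus_iff: "a \<in> H_plus \<longleftrightarrow> a 0 = 0 \<and> (\<forall>k. twist (1 / real (Suc k)) a \<in> H2)"
proof
  assume "a \<in> H_plus"
  then show "a 0 = 0 \<and> (\<forall>k. twist (1 / real (Suc k)) a \<in> H2)"
    by (simp add: H_plus_def twist_def)
next
  assume a: "a 0 = 0 \<and> (\<forall>k. twist (1 / real (Suc k)) a \<in> H2)"
  have "twist \<sigma> a \<in> H2" if \<sigma>: "\<sigma> > 0" for \<sigma>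
  proof -
    obtain k where "1 / real (Suc k) < \<sigma>"
      using reals_Archimedean[OF \<sigma>] by (auto simp: inverse_eq_divide)
    then show ?thesis using a twist_H2_mono(1)[of "1 / real (Suc k)" \<sigma> a] by auto
  qed
  then show "a \<in> H_plus" using a by (simp add: H_plus_def twist_def)
qed

lemma H_plus_twist: "a \<in> H_plus \<Longrightarrow> t > 0 \<Longrightarrow> twist t a \<in> H2"
  by (simp add: H_plus_def twist_def)

text \<open>Continuity of the coordinate functionals. It yields definiteness of the seminorms,
  coordinatewise limits of Cauchy sequences, uniqueness of expansions and the trace
  estimate.\<close>

lemma cmod_coord_le:
  assumes "a \<in> H_plus"
  shows "cmod (a n) \<le> real n powr (1 / real (Suc k)) * H_plus_seminorm (Suc k) a"
proof (cases "n = 0")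
  case True
  then show ?thesis using assms by (simp add: H_plus_def)
next
  case False
  define w where "w = real n powr (1 / real (Suc k))"
  have w: "w > 0" using False by (simp add: w_def)
  have "cmod (twist (1 / real (Suc k)) a n) \<le> H_plus_seminorm (Suc k) a"
    unfolding H_plus_seminorm_twist using assms by (intro H2_coord_le H_plus_twist) auto
  then have "cmod (a n) / w \<le> H_plus_seminorm (Suc k) a"
    by (simp add: cmod_twist powr_minus divide_inverse w_def)
  then show ?thesis unfolding w_def[symmetric] using w by (simp add: field_simps)
qed

section \<open>The space of Dirichlet series as a graded space; completeness\<close>

text \<open>The shift by \<open>Suc\<close> matters: \<open>1 / real 0 = 0\<close>, so index 0 would
  stand for the unweighted norm, whose defining series can diverge on \<open>H_plus\<close>.\<close>

interpretation HP: graded_seminorms dirichlet_scale H_plus "\<lambda>k. H_plus_seminorm (Suc k)"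
proof -
  have vs: "vector_space dirichlet_scale"
    by unfold_locales (auto simp: dirichlet_scale_def fun_eq_iff algebra_simps)
  interpret vector_space dirichlet_scale by (fact vs)
  show "graded_seminorms dirichlet_scale H_plus (\<lambda>k. H_plus_seminorm (Suc k))"
  proof
    have "x + y \<in> H_plus" if "x \<in> H_plus" "y \<in> H_plus" for x y
      using that H2_add(1) by (simp add: H_plus_iff twist_add)
    moreover have "dirichlet_scale c x \<in> H_plus" if "x \<in> H_plus" for c x
      using that H2_scale(1) by (simp add: H_plus_iff twist_scale) (simp add: dirichlet_scale_def)
    moreover have "0 \<in> H_plus" by (simp add: H_plus_def H2_def)
    ultimately show "subspace H_plus" by (simp add: subspace_def)
  next
    fix k m x y c
    assume x: "x \<in> H_plus"
    have x': "twist (1 / real (Suc k)) x \<in> H2" for k by (rule H_plus_twist[OF x]) simp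
    show "0 \<le> H_plus_seminorm (Suc k) x"
      using H2_norm_nonneg[OF x'] by (simp add: H_plus_seminorm_twist)
    show "H_plus_seminorm (Suc k) (dirichlet_scale c x) = cmod c * H_plus_seminorm (Suc k) x"
      using H2_scale(2)[OF x'] by (simp add: H_plus_seminorm_twist twist_scale)
    show "H_plus_seminorm (Suc k) (x + y) \<le> H_plus_seminorm (Suc k) x + H_plus_seminorm (Suc k) y"
      if "y \<in> H_plus"
      using that H2_add(2)[OF x'] by (simp add: H_plus_seminorm_twist twist_add H_plus_iff)
    show "H_plus_seminorm (Suc m) x \<le> H_plus_seminorm (Suc k) x" if "m \<le> k"
      unfolding H_plus_seminorm_twist using that by (intro twist_H2_mono(2) x') (simp add: field_simps)
    show "x = 0" if "H_plus_seminorm (Suc 0) x = 0"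
      using cmod_coord_le[OF x, of _ 0] that by (auto simp: fun_eq_iff)
  qed
qed

lemma T_eq_H_plus_topology: "HP.T = H_plus_topology"
proof -
  have "{{b \<in> H_plus. H_plus_seminorm (Suc k) (b - a) < r} |a k r. a \<in> H_plus \<and> r > 0} =
    {{b \<in> H_plus. H_plus_seminorm k (b - a) < r} |a k r. a \<in> H_plus \<and> k \<ge> 1 \<and> r > 0}"
    (is "?L = ?R")
  proof
    have "{b \<in> H_plus. H_plus_seminorm (Suc k) (b - a) < r} \<in> ?R" if "a \<in> H_plus" "r > 0" for a k r
      using that le_add1[of 1 k] unfolding plus_1_eq_Suc by blast
    then show "?L \<subseteq> ?R" by blast
    have "{b \<in> H_plus. H_plus_seminorm k (b - a) < r} \<in> ?L" if "a \<in> H_plus" and k: "k \<ge> 1" and "r > 0" for a k r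
    proof -
      obtain m where "k = Suc m" using k by (cases k) auto
      then show ?thesis using that by blast
    qed
    then show "?R \<subseteq> ?L" by blast
  qed
  then show ?thesis by (simp add: HP.T_def H_plus_topology_def)
qed

lemma frechet_space_H_plus: "frechet_space dirichlet_scale H_plus_topology"
  unfolding T_eq_H_plus_topology[symmetric]
proof (rule HP.frechet_spaceI)
  fix x :: "nat \<Rightarrow> nat \<Rightarrow> complex"
  assume "range x \<subseteq> H_plus"
    and cauchy: "\<And>k e. e > 0 \<Longrightarrow> \<exists>N. \<forall>m\<ge>N. \<forall>n\<ge>N. H_plus_seminorm (Suc k) (x m - x n) < e"
  then have x: "x n \<in> H_plus" for n by blast
  have "convergent (\<lambda>n. x n i)" for i
    unfolding Cauchy_convergent_iff[symmetric]
  proof (rule CauchyI)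
    fix e :: real assume e: "e > 0"
    \<comment> \<open>The factor of the coordinate estimate, raised by 1 to stay positive at i =
      0.\<close>
    define B where "B = real i powr 1 + 1"
    have B: "B > 0" by (simp add: B_def add_nonneg_pos)
    obtain N where N: "\<forall>m\<ge>N. \<forall>n\<ge>N. H_plus_seminorm (Suc 0) (x m - x n) < e / B"
      using cauchy[of "e / B" 0] e B by auto
    have "cmod (x m i - x n i) < e" if "m \<ge> N" "n \<ge> N" for m n
    proof -
      have "cmod (x m i - x n i) \<le> real i powr 1 * H_plus_seminorm (Suc 0) (x m - x n)"
        using cmod_coord_le[OF HP.E_diff[OF x x], of m n i 0] by simp
      also have "\<dots> \<le> B * H_plus_seminorm (Suc 0) (x m - x n)"
        using HP.p_nonneg[OF HP.E_diff[OF x x]] by (intro mult_right_mono) (auto simp: B_def)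
      also have "\<dots> < e" using N that B by (simp add: field_simps)
      finally show ?thesis .
    qed
    then show "\<exists>N. \<forall>m\<ge>N. \<forall>n\<ge>N. norm (x m i - x n i) < e" by blast
  qed
  then obtain l where l: "\<And>i. (\<lambda>n. x n i) \<longlonglongrightarrow> l i"
    unfolding convergent_def by metis
  have tw: "twist (1 / real (Suc k)) l \<in> H2 \<and>
      (\<lambda>n. H2_norm (twist (1 / real (Suc k)) (x n) - twist (1 / real (Suc k)) l)) \<longlonglongrightarrow> 0" for k
  proof -
    define t where "t = 1 / real (Suc k)"
    have H2: "twist t (x m) \<in> H2" for m using x by (simp add: H_plus_iff t_def)
    have cau: "\<exists>N. \<forall>m\<ge>N. \<forall>n\<ge>N. H2_norm (twist t (x m) - twist t (x n)) < e" if "e > 0" for e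
      using cauchy[OF that, of k] by (simp add: H_plus_seminorm_twist twist_diff t_def)
    \<comment> \<open>Index 0 is separated because the divisor vanishes there; both sides are then
      0.\<close>
    have lim: "(\<lambda>n. twist t (x n) i) \<longlonglongrightarrow> twist t l i" for i
    proof (cases "i = 0")
      case False
      then show ?thesis unfolding twist_def by (intro tendsto_intros l) simp
    qed simp
    from H2_pointwise_limit[of "\<lambda>n. twist t (x n)", OF H2 cau lim]
    show ?thesis unfolding t_def by (rule conjI)
  qed
  have "x n 0 = 0" for n using x by (simp add: H_plus_def)
  then have "l 0 = 0" using l[of 0] by (simp add: LIMSEQ_const_iff)
  with tw show "\<exists>l\<in>H_plus. \<forall>k. (\<lambda>n. H_plus_seminorm (Suc k) (x n - l)) \<longlonglongrightarrow> 0"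
    by (intro bexI[of _ l]) (auto simp: H_plus_iff H_plus_seminorm_twist twist_diff)
qed

section \<open>The Schwartz property\<close>

lemma floor_divide_eq_imp_close:
  fixes a b \<delta> :: real
  assumes "\<delta> > 0" "\<lfloor>a / \<delta>\<rfloor> = \<lfloor>b / \<delta>\<rfloor>"
  shows "\<bar>a - b\<bar> < \<delta>"
proof -
  have "\<bar>a / \<delta> - b / \<delta>\<bar> < 1"
    using floor_correct[of "a / \<delta>"] floor_correct[of "b / \<delta>"] assms(2) by linarith
  then have "\<bar>(a - b) / \<delta>\<bar> < 1" by (simp add: diff_divide_distrib)
  then show ?thesis using assms(1) by (simp add: abs_divide)
qed

text \<open>Pigeonhole on a grid of mesh \<delta>: \<open>key\<close> records the cell of the first
  M coordinates, boundedness leaves finitely many cells, and one point of V from each occupied cell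
  forms the net. Choosing representatives by \<open>inv_into\<close> keeps the net inside V.\<close>

lemma finite_net_first_coordinates:
  fixes V :: "(nat \<Rightarrow> complex) set" and B e :: real
  assumes bd: "\<And>y n. y \<in> V \<Longrightarrow> n < M \<Longrightarrow> cmod (y n) \<le> B" and e: "e > 0"
  shows "\<exists>F. finite F \<and> F \<subseteq> V \<and> (\<forall>y\<in>V. \<exists>x\<in>F. (\<Sum>n<M. cmod (y n - x n)) < e)"
proof -
  \<comment> \<open>Real and imaginary parts cost \<delta> each in M coordinates, hence 2M\<delta>
    in all; the summand 1 makes the final inequality strict and covers M = 0.\<close>
  define \<delta> where "\<delta> = e / (2 * real M + 1)"
  have \<delta>: "\<delta> > 0" "real M * (2 * \<delta>) < e" using e by (auto simp: \<delta>_def field_simps)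
  define key where "key = (\<lambda>y. \<lambda>n\<in>{..<M}. (\<lfloor>Re (y n) / \<delta>\<rfloor>, \<lfloor>Im (y n) / \<delta>\<rfloor>))"
  have fl: "\<lfloor>t / \<delta>\<rfloor> \<in> {\<lfloor>- B / \<delta>\<rfloor>..\<lfloor>B / \<delta>\<rfloor>}" if "\<bar>t\<bar> \<le> B" for t
    using that \<delta>(1) unfolding atLeastAtMost_iff by (intro conjI floor_mono divide_right_mono) auto
  have "key ` V \<subseteq> {..<M} \<rightarrow>\<^sub>E {\<lfloor>- B / \<delta>\<rfloor>..\<lfloor>B / \<delta>\<rfloor>} \<times> {\<lfloor>- B / \<delta>\<rfloor>..\<lfloor>B / \<delta>\<rfloor>}"
  proof
    fix k assume "k \<in> key ` V"
    then obtain y where y: "y \<in> V" "k = key y" by blast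
    have "(\<lfloor>Re (y n) / \<delta>\<rfloor>, \<lfloor>Im (y n) / \<delta>\<rfloor>) \<in> {\<lfloor>- B / \<delta>\<rfloor>..\<lfloor>B / \<delta>\<rfloor>} \<times> {\<lfloor>- B / \<delta>\<rfloor>..\<lfloor>B / \<delta>\<rfloor>}" if "n < M" for n
      using fl[of "Re (y n)"] fl[of "Im (y n)"] bd[OF y(1) that] abs_Re_le_cmod[of "y n"]
        abs_Im_le_cmod[of "y n"] by (intro SigmaI) auto
    then show "k \<in> {..<M} \<rightarrow>\<^sub>E {\<lfloor>- B / \<delta>\<rfloor>..\<lfloor>B / \<delta>\<rfloor>} \<times> {\<lfloor>- B / \<delta>\<rfloor>..\<lfloor>B / \<delta>\<rfloor>}"
      unfolding y(2) key_def by (intro restrict_PiE_iff[THEN iffD2]) blast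
  qed
  then have fin: "finite (key ` V)"
    by (rule finite_subset) (intro finite_PiE finite_SigmaI; simp)
  define F where "F = inv_into V key ` (key ` V)"
  have "\<exists>x\<in>F. (\<Sum>n<M. cmod (y n - x n)) < e" if y: "y \<in> V" for y
  proof
    define x where "x = inv_into V key (key y)"
    show "x \<in> F" using y by (simp add: F_def x_def)
    have key: "key x = key y" unfolding x_def by (rule f_inv_into_f[OF imageI[OF y]])
    have "cmod (y n - x n) \<le> 2 * \<delta>" if "n < M" for n
    proof -
      from fun_cong[OF key, of n] that
      have "\<lfloor>Re (y n) / \<delta>\<rfloor> = \<lfloor>Re (x n) / \<delta>\<rfloor>" "\<lfloor>Im (y n) / \<delta>\<rfloor> = \<lfloor>Im (x n) / \<delta>\<rfloor>"
        by (simp_all add: key_def)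
      then have "\<bar>Re (y n) - Re (x n)\<bar> < \<delta>" "\<bar>Im (y n) - Im (x n)\<bar> < \<delta>"
        using floor_divide_eq_imp_close \<delta>(1) by blast+
      then show ?thesis using cmod_le[of "y n - x n"] by simp
    qed
    then have "(\<Sum>n<M. cmod (y n - x n)) \<le> real M * (2 * \<delta>)"
      using sum_bounded_above[of "{..<M}" "\<lambda>n. cmod (y n - x n)" "2 * \<delta>"] by simp
    then show "(\<Sum>n<M. cmod (y n - x n)) < e" using \<delta>(2) by linarith
  qed
  moreover have "finite F" "F \<subseteq> V"
    using fin by (auto simp: F_def intro: inv_into_into)
  ultimately show ?thesis by blast
qed

text \<open>Quantitative compactness of the inclusion between weighted spaces. From index M on, the
  multiplier n^(-(t-s)) is at most M^(-(t-s)); below M the crude l^1 norm is affordable because only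
  finitely many coordinates occur.\<close>

lemma twist_split_bound:
  assumes u: "twist s u \<in> H2" and st: "0 \<le> s" "s < t" and M: "M \<ge> 1"
  shows "H2_norm (twist t u) \<le> (\<Sum>n<M. cmod (u n)) + real M powr (- (t - s)) * H2_norm (twist s u)"
proof (rule H2_I(2))
  fix J
  define A where "A = (\<lambda>n. if n < M then cmod (u n) else 0)"
  define C where "C = real M powr (- (t - s))"
  have "cmod (twist t u n) \<le> A n + C * cmod (twist s u n)" for n
  proof (cases "n < M")
    case True
    have "cmod (twist t u n) \<le> cmod (u n)"
    proof (cases "n = 0")
      case False
      then have "real n powr (- t) \<le> real n powr 0" using st by (intro powr_mono) auto
      then show ?thesis using False by (simp add: cmod_twist mult_left_le)
    qed simp
    then show ?thesis using True by (simp add: A_def C_def add_increasing2)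
  next
    case False
    have "real n powr (- (t - s)) \<le> C"
      unfolding C_def using False M st by (intro powr_mono2') auto
    then have "cmod (twist s u n) * real n powr (- (t - s)) \<le> cmod (twist s u n) * C"
      by (intro mult_left_mono) auto
    moreover have "cmod (twist t u n) = cmod (twist s u n) * real n powr (- (t - s))"
      by (simp add: cmod_twist mult.assoc flip: powr_add)
    ultimately show ?thesis using False by (simp add: A_def mult.commute)
  qed
  then have "L2_set (\<lambda>n. cmod (twist t u n)) {..<J} \<le> L2_set (\<lambda>n. A n + C * cmod (twist s u n)) {..<J}"
    by (intro L2_set_mono) auto
  also have "\<dots> \<le> L2_set A {..<J} + L2_set (\<lambda>n. C * cmod (twist s u n)) {..<J}"
    by (rule L2_set_triangle_ineq)
  also have "L2_set A {..<J} \<le> sum A {..<J}"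
    by (intro L2_set_le_sum) (auto simp: A_def)
  \<comment> \<open>J and M are not ordered, so the passage from one range to the other goes through
    their union; A vanishes from M on.\<close>
  also have "sum A {..<J} \<le> sum A ({..<J} \<union> {..<M})"
    by (intro sum_mono2) (auto simp: A_def)
  also have "\<dots> = sum A {..<M}"
    by (rule sum.mono_neutral_right) (auto simp: A_def)
  also have "\<dots> = (\<Sum>n<M. cmod (u n))" by (simp add: A_def)
  also have "L2_set (\<lambda>n. C * cmod (twist s u n)) {..<J} \<le> C * H2_norm (twist s u)"
    using H2_L2_set_le[OF u, of "{..<J}"]
    by (simp add: L2_set_right_distrib[symmetric] C_def mult_left_mono)
  finally show "L2_set (\<lambda>n. cmod (twist t u n)) {..<J}
      \<le> (\<Sum>n<M. cmod (u n)) + real M powr (- (t - s)) * H2_norm (twist s u)"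
    by (simp add: C_def)
qed simp

lemma schwartz_space_H_plus: "schwartz_space dirichlet_scale H_plus_topology"
  unfolding T_eq_H_plus_topology[symmetric]
proof (rule HP.schwartz_spaceI)
  fix k
  show "\<exists>m. \<forall>\<epsilon>>0. \<exists>F. finite F \<and> F \<subseteq> {x \<in> H_plus. H_plus_seminorm (Suc m) x < 1} \<and>
      (\<forall>y\<in>H_plus. H_plus_seminorm (Suc m) y < 1 \<longrightarrow> (\<exists>x\<in>F. H_plus_seminorm (Suc k) (y - x) < \<epsilon>))"
  \<comment> \<open>The next seminorm suffices, since any positive gap t - s makes the tail factor
    tend to 0.\<close>
  proof (intro exI[of _ "Suc k"] allI impI)
    fix \<epsilon> :: real
    assume \<epsilon>: "\<epsilon> > 0"
    define s t where "s = 1 / real (Suc (Suc k))" and "t = 1 / real (Suc k)"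
    have st: "0 \<le> s" "s \<le> 1" "s < t" by (auto simp: s_def t_def field_simps)
    let ?V = "{x \<in> H_plus. H_plus_seminorm (Suc (Suc k)) x < 1}"
    have "((\<lambda>M. real M powr (- (t - s))) \<longlongrightarrow> 0) sequentially"
      using st by (intro tendsto_neg_powr filterlim_real_sequentially) auto
    then have "eventually (\<lambda>M. real M powr (- (t - s)) < \<epsilon> / 4) sequentially"
      using \<epsilon> by (intro order_tendstoD) auto
    \<comment> \<open>Two points of the unit ball differ by less than 2 in the stronger seminorm, so
      the tail costs less than \<epsilon>/2 and the net may spend the other half.\<close>
    then obtain M where M: "M \<ge> 1" "real M powr (- (t - s)) < \<epsilon> / 4"
      unfolding eventually_sequentially by (metis le_add1 le_add2)
    have "cmod (y n) \<le> real M" if y: "y \<in> ?V" and n: "n < M" for y n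
    proof -
      have "cmod (y n) \<le> real n powr s * H_plus_seminorm (Suc (Suc k)) y"
        using cmod_coord_le[of y n "Suc k"] y unfolding s_def by simp
      also have "\<dots> \<le> real n powr s * 1" using y by (intro mult_left_mono) auto
      also have "\<dots> \<le> real M"
      proof (cases "n = 0")
        case False
        then have "real n powr s \<le> real n powr 1" using st by (intro powr_mono) auto
        then show ?thesis using n by simp
      qed simp
      finally show ?thesis .
    qed
    then have "\<exists>F. finite F \<and> F \<subseteq> ?V \<and> (\<forall>y\<in>?V. \<exists>x\<in>F. (\<Sum>n<M. cmod (y n - x n)) < \<epsilon> / 2)"
      by (rule finite_net_first_coordinates) (use \<epsilon> in auto)
    then obtain F where F: "finite F" "F \<subseteq> ?V"
        "\<forall>y\<in>?V. \<exists>x\<in>F. (\<Sum>n<M. cmod (y n - x n)) < \<epsilon> / 2"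
      by (elim exE conjE)
    have "\<exists>x\<in>F. H_plus_seminorm (Suc k) (y - x) < \<epsilon>" if y: "y \<in> ?V" for y
    proof -
      obtain x where x: "x \<in> F" "(\<Sum>n<M. cmod (y n - x n)) < \<epsilon> / 2" using bspec[OF F(3) y] by blast
      have xy: "y \<in> H_plus" "x \<in> H_plus" using x F(2) y by auto
      have "H_plus_seminorm (Suc (Suc k)) (y - x) < 2"
        using HP.p_triangle3[OF xy(1) HP.E_zero xy(2), of "Suc k"]
          HP.p_minus_commute[OF xy(2) HP.E_zero, of "Suc k"] x(1) F(2) y by auto
      then have 2: "H2_norm (twist s (y - x)) < 2" by (simp add: H_plus_seminorm_twist s_def)
      have s': "twist s (y - x) \<in> H2"
        using HP.E_diff[OF xy] unfolding s_def by (intro H_plus_twist) auto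
      have "H2_norm (twist t (y - x))
          \<le> (\<Sum>n<M. cmod (y n - x n)) + real M powr (- (t - s)) * H2_norm (twist s (y - x))"
        using twist_split_bound[OF s' st(1,3) M(1)] by simp
      also have "\<dots> < \<epsilon> / 2 + \<epsilon> / 4 * 2"
        using x(2) M(2) 2 H2_norm_nonneg[OF s'] by (intro add_strict_mono mult_strict_mono') auto
      finally have "H_plus_seminorm (Suc k) (y - x) < \<epsilon>"
        by (simp add: H_plus_seminorm_twist t_def)
      then show ?thesis using x(1) by blast
    qed
    then show "\<exists>F. finite F \<and> F \<subseteq> ?V \<and>
        (\<forall>y\<in>H_plus. H_plus_seminorm (Suc (Suc k)) y < 1 \<longrightarrow> (\<exists>x\<in>F. H_plus_seminorm (Suc k) (y - x) < \<epsilon>))"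
      using F(1,2) by (intro exI[of _ F]) auto
  qed
qed

section \<open>The divisor bound and the product\<close>

text \<open>Multiplying a divisor of m by a divisor of n reaches every divisor of mn, possibly more
  than once; the divisor bound below asks only for this one-sided estimate.\<close>

lemma card_divisors_mult_le:
  fixes m n :: nat
  assumes "m > 0" "n > 0"
  shows "card {d. d dvd m * n} \<le> card {d. d dvd m} * card {d. d dvd n}"
proof -
  have "{d. d dvd m * n} \<subseteq> (\<lambda>(a, b). a * b) ` ({d. d dvd m} \<times> {d. d dvd n})"
  proof
    fix d assume "d \<in> {d. d dvd m * n}"
    then obtain a b where "d = a * b" "a dvd m" "b dvd n" using division_decomp[of d m n] by auto
    then show "d \<in> (\<lambda>(a, b). a * b) ` ({d. d dvd m} \<times> {d. d dvd n})" by auto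
  qed
  then have "card {d. d dvd m * n} \<le> card ((\<lambda>(a, b). a * b) ` ({d. d dvd m} \<times> {d. d dvd n}))"
    using assms by (intro card_mono) auto
  also have "\<dots> \<le> card ({d. d dvd m} \<times> {d. d dvd n})"
    using assms by (intro card_image_le) auto
  finally show ?thesis by (simp add: card_cartesian_product)
qed

lemma card_divisors_prime_power_le:
  fixes p :: nat
  assumes "prime p"
  shows "card {d. d dvd p ^ a} \<le> a + 1"
proof -
  have "{d. d dvd p ^ a} \<subseteq> (\<lambda>i. p ^ i) ` {..a}"
    using divides_primepow_nat[OF assms] by auto
  then have "card {d. d dvd p ^ a} \<le> card {..a}"
    by (meson card_image_le card_mono finite_atMost finite_imageI le_trans)
  then show ?thesis by simp
qed

text \<open>Prime powers \<open>p\<^sup>a\<close> with \<open>p\<^sup>\<epsilon> \<ge> 2\<close> have at most \<open>p\<^sup>a\<^sup>\<epsilon>\<close> divisors, so only the boundedly many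
  smaller primes contribute a constant factor.\<close>

lemma card_divisors_le_powr:
  fixes \<epsilon> :: real
  assumes "\<epsilon> > 0"
  obtains C where "C > 0" "\<And>n. n > 0 \<Longrightarrow> real (card {d. d dvd n}) \<le> C * real n powr \<epsilon>"
proof -
  define B where "B = nat \<lceil>2 powr (1 / \<epsilon>)\<rceil>"
  have B: "2 \<le> real q powr \<epsilon>" if "q \<ge> B" for q
  proof -
    have "2 powr (1 / \<epsilon>) \<le> real q" using that unfolding B_def by linarith
    then have "(2 powr (1 / \<epsilon>)) powr \<epsilon> \<le> real q powr \<epsilon>" using assms by (intro powr_mono2) auto
    then show ?thesis using assms by (simp add: powr_powr)
  qed
  \<comment> \<open>With L = \<epsilon> ln 2 this gives K(1 + aL) \<ge> a + 1, as the part 1/L of K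
    turns aL into a; and 1 + aL \<le> exp(aL) = 2^(\<epsilon> a).\<close>
  define K where "K = 1 + 1 / (\<epsilon> * ln 2)"
  have K: "K \<ge> 1" using assms by (simp add: K_def)
  have small: "real (a + 1) \<le> K * (2 powr \<epsilon>) ^ a" for a :: nat
  proof -
    have L: "\<epsilon> * ln 2 > 0" using assms by simp
    have "real (a + 1) \<le> K * (1 + real a * (\<epsilon> * ln 2))"
    proof -
      have "K * (1 + real a * (\<epsilon> * ln 2)) = 1 + 1 / (\<epsilon> * ln 2) + real a * (\<epsilon> * ln 2) + real a"
        using L assms by (simp add: K_def field_simps)
      moreover have "0 \<le> 1 / (\<epsilon> * ln 2)" "0 \<le> real a * (\<epsilon> * ln 2)" using L by auto
      ultimately show ?thesis by simp
    qed
    also have "\<dots> \<le> K * exp (real a * (\<epsilon> * ln 2))"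
      using K exp_ge_add_one_self by (intro mult_left_mono) auto
    also have "exp (real a * (\<epsilon> * ln 2)) = (2 powr \<epsilon>) ^ a"
      by (simp add: powr_def exp_of_nat_mult mult.commute)
    finally show ?thesis .
  qed
  \<comment> \<open>The exponent of K in the induction counts the small primes dividing n, so each
    pays its factor K once and the total never exceeds K^B.\<close>
  define P where "P = (\<lambda>n. {q. prime q \<and> q < B \<and> q dvd n})"
  have finP: "finite (P n)" and cardP: "card (P n) \<le> B" for n
  proof -
    have "P n \<subseteq> {..<B}" by (auto simp: P_def)
    then show "finite (P n)" "card (P n) \<le> B"
      using finite_subset card_mono[of "{..<B}" "P n"] by auto
  qed
  have main: "real (card {d. d dvd n}) \<le> K ^ card (P n) * real n powr \<epsilon>" if "n > 0" for n
    using that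
  proof (induction n rule: less_induct)
    case (less n)
    show ?case
    proof (cases "n = 1")
      case True
      then show ?thesis using K by simp
    next
      case False
      then obtain q where q: "prime q" "q dvd n" using prime_factor_nat by blast
      obtain m where m: "n = q ^ multiplicity q n * m" "\<not> q dvd m"
        using multiplicity_decompose'[of n q] less.prems q(1) not_prime_unit by blast
      define a where "a = multiplicity q n"
      have n: "n = q ^ a * m" using m(1) by (simp add: a_def)
      have m0: "m > 0" using less.prems m(1) by (cases m) auto
      have "a \<noteq> 0" using q(2) m(2) n by (cases a) auto
      then have "1 < q ^ a" using prime_gt_1_nat[OF q(1)] by (intro one_less_power) auto
      then have mn: "m < n" using m0 n by simp
      have "real (card {d. d dvd n}) \<le> real (a + 1) * real (card {d. d dvd m})"
      proof -
        have "card {d. d dvd n} \<le> card {d. d dvd q ^ a} * card {d. d dvd m}"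
          unfolding n using m0 prime_gt_0_nat[OF q(1)] by (intro card_divisors_mult_le) auto
        also have "\<dots> \<le> (a + 1) * card {d. d dvd m}"
          using card_divisors_prime_power_le[OF q(1), of a] by (intro mult_right_mono) auto
        finally show ?thesis by (metis of_nat_le_iff of_nat_mult)
      qed
      also have "\<dots> \<le> real (a + 1) * (K ^ card (P m) * real m powr \<epsilon>)"
        using less.IH[OF mn m0] by (intro mult_left_mono) auto
      also have "\<dots> \<le> K ^ card (P n) * (real q powr \<epsilon>) ^ a * real m powr \<epsilon>"
      proof (cases "q < B")
        case True
        \<comment> \<open>The full power of q has been removed from n, so q is missing from
          \<open>P m\<close> and its return pays for the new factor K.\<close>
        have "card (insert q (P m)) = Suc (card (P m))"
          using m(2) finP by (intro card_insert_disjoint) (auto simp: P_def)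
        moreover have "insert q (P m) \<subseteq> P n" using q True n by (auto simp: P_def)
        ultimately have c: "Suc (card (P m)) \<le> card (P n)" using finP by (metis card_mono)
        have "real (a + 1) * K ^ card (P m) \<le> K * (2 powr \<epsilon>) ^ a * K ^ card (P m)"
          using small K by (intro mult_right_mono) auto
        also have "\<dots> = K ^ Suc (card (P m)) * (2 powr \<epsilon>) ^ a" by simp
        also have "\<dots> \<le> K ^ card (P n) * (real q powr \<epsilon>) ^ a"
          using c K assms prime_ge_2_nat[OF q(1)]
          by (intro mult_mono power_increasing power_mono powr_mono2) auto
        finally have "real (a + 1) * K ^ card (P m) \<le> K ^ card (P n) * (real q powr \<epsilon>) ^ a" .
        from mult_right_mono[OF this, of "real m powr \<epsilon>"] show ?thesis by (simp add: mult_ac)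
      next
        case False
        have "P m \<subseteq> P n" using n by (auto simp: P_def)
        then have c: "card (P m) \<le> card (P n)" using finP by (simp add: card_mono)
        have "real (a + 1) \<le> 2 ^ a" by (induction a) auto
        also have "\<dots> \<le> (real q powr \<epsilon>) ^ a" using B False by (intro power_mono) auto
        finally have "real (a + 1) * K ^ card (P m) \<le> (real q powr \<epsilon>) ^ a * K ^ card (P n)"
          using c K by (intro mult_mono power_increasing) auto
        from mult_right_mono[OF this, of "real m powr \<epsilon>"] show ?thesis by (simp add: mult_ac)
      qed
      also have "\<dots> = K ^ card (P n) * real n powr \<epsilon>"
      proof -
        have "(real q ^ a) powr \<epsilon> = (real q powr \<epsilon>) ^ a"
          by (induction a) (simp_all add: powr_mult)
        then have "real n powr \<epsilon> = (real q powr \<epsilon>) ^ a * real m powr \<epsilon>"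
          by (subst n) (simp add: powr_mult)
        then show ?thesis by simp
      qed
      finally show ?thesis .
    qed
  qed
  show thesis
  proof (rule that)
    show "K ^ B > 0" using K by simp
    fix n :: nat assume "n > 0"
    have "K ^ card (P n) \<le> K ^ B" using K cardP by (intro power_increasing)
    then have "K ^ card (P n) * real n powr \<epsilon> \<le> K ^ B * real n powr \<epsilon>" by (intro mult_right_mono) auto
    then show "real (card {d. d dvd n}) \<le> K ^ B * real n powr \<epsilon>" using main[OF \<open>n > 0\<close>] by linarith
  qed
qed

section \<open>Dirichlet convolution on the weighted spaces\<close>

text \<open>(n, d) \<mapsto> (d, n div d) embeds the pairs on the left into the square of side M,
  and the terms are nonnegative. The index 0 is excluded, as it has infinitely many
  divisors.\<close>

lemma sum_divisors_convolution_le: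
  fixes f g :: "nat \<Rightarrow> real"
  assumes "\<And>n. 0 \<le> f n" "\<And>n. 0 \<le> g n"
  shows "(\<Sum>n\<in>{1..<M}. \<Sum>d | d dvd n. f d * g (n div d)) \<le> (\<Sum>d<M. f d) * (\<Sum>e<M. g e)"
proof -
  let ?D = "SIGMA n:{1..<M}. {d. d dvd n}"
  let ?h = "\<lambda>(n, d). (d, n div d)"
  have inj: "inj_on ?h ?D" by (auto simp: inj_on_def)
  have sub: "?h ` ?D \<subseteq> {..<M} \<times> {..<M}"
    by (auto dest!: dvd_imp_le intro: le_less_trans[OF div_le_dividend])
  have "(\<Sum>n\<in>{1..<M}. \<Sum>d | d dvd n. f d * g (n div d)) = (\<Sum>(n, d)\<in>?D. f d * g (n div d))"
    by (rule sum.Sigma) auto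
  also have "\<dots> = (\<Sum>(d, e)\<in>?h ` ?D. f d * g e)"
    by (subst sum.reindex[OF inj]) (auto intro!: sum.cong)
  also have "\<dots> \<le> (\<Sum>(d, e)\<in>{..<M} \<times> {..<M}. f d * g e)"
    using assms by (intro sum_mono2 sub) auto
  also have "\<dots> = (\<Sum>d<M. f d) * (\<Sum>e<M. g e)"
    by (simp add: sum_product sum.cartesian_product)
  finally show ?thesis .
qed

text \<open>Cauchy-Schwarz over the divisors costs their number, at most C n^t, which turns the
  squared weight n^(-2t) into C n^(-t). This remaining weight factors as d^(-t) (n/d)^(-t), the
  product of the squared weights for the exponent t/2; hence the halving.\<close>

lemma twist_dirichlet_mult:
  assumes a: "twist (t / 2) a \<in> H2" and b: "twist (t / 2) b \<in> H2" and C: "C > 0"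
    and dv: "\<And>n. n > 0 \<Longrightarrow> real (card {d. d dvd n}) \<le> C * real n powr t"
  shows "twist t (dirichlet_mult a b) \<in> H2"
    and "H2_norm (twist t (dirichlet_mult a b)) \<le> sqrt C * H2_norm (twist (t / 2) a) * H2_norm (twist (t / 2) b)"
proof -
  define f g where "f = (\<lambda>n. (cmod (twist (t / 2) a n))\<^sup>2)" and "g = (\<lambda>n. (cmod (twist (t / 2) b n))\<^sup>2)"
  let ?A = "H2_norm (twist (t / 2) a)" and ?B = "H2_norm (twist (t / 2) b)"
  have term_le: "(cmod (twist t (dirichlet_mult a b) n))\<^sup>2 \<le> C * (\<Sum>d | d dvd n. f d * g (n div d))"
    if n: "n > 0" for n
  proof -
    have pw: "real n powr (- t) * real n powr (- t) * real n powr t = real n powr (- t)"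
      using n by (simp flip: powr_add)
    have "(cmod (dirichlet_mult a b n))\<^sup>2 \<le> (\<Sum>d | d dvd n. cmod (a d * b (n div d)))\<^sup>2"
      unfolding dirichlet_mult_def by (intro power_mono norm_sum) auto
    also have "\<dots> \<le> (\<Sum>d | d dvd n. (cmod (a d * b (n div d)))\<^sup>2) * real (card {d. d dvd n})"
      by (rule sum_squared_le_sum_of_squares)
    also have "\<dots> \<le> (\<Sum>d | d dvd n. (cmod (a d * b (n div d)))\<^sup>2) * (C * real n powr t)"
      using dv[OF n] by (intro mult_left_mono) (auto intro: sum_nonneg)
    finally have "(cmod (dirichlet_mult a b n))\<^sup>2 * (real n powr (- t))\<^sup>2 \<le>
        (\<Sum>d | d dvd n. (cmod (a d * b (n div d)))\<^sup>2) * (C * real n powr t) * (real n powr (- t))\<^sup>2"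
      by (intro mult_right_mono) auto
    also have "\<dots> = C * ((\<Sum>d | d dvd n. (cmod (a d * b (n div d)))\<^sup>2) *
        (real n powr (- t) * real n powr (- t) * real n powr t))"
      by (simp add: power2_eq_square algebra_simps)
    also have "\<dots> = C * (\<Sum>d | d dvd n. (cmod (a d * b (n div d)))\<^sup>2 * real n powr (- t))"
      unfolding pw by (simp add: sum_distrib_right)
    also have "(\<Sum>d | d dvd n. (cmod (a d * b (n div d)))\<^sup>2 * real n powr (- t)) =
        (\<Sum>d | d dvd n. f d * g (n div d))"
    proof (rule sum.cong)
      fix d assume "d \<in> {d. d dvd n}"
      then have "real n = real d * real (n div d)"
        by (metis dvd_mult_div_cancel mem_Collect_eq of_nat_mult)
      then have "real n powr (- t) = real d powr (- t) * real (n div d) powr (- t)"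
        by (simp add: powr_mult)
      moreover have "(real k powr (- (t / 2)))\<^sup>2 = real k powr (- t)" for k
        by (simp add: power2_eq_square flip: powr_add)
      ultimately show "(cmod (a d * b (n div d)))\<^sup>2 * real n powr (- t) = f d * g (n div d)"
        by (simp add: f_def g_def cmod_twist power_mult_distrib norm_mult)
    qed simp
    finally show ?thesis by (simp add: cmod_twist power_mult_distrib)
  qed
  have AB: "?A \<ge> 0" "?B \<ge> 0" using a b H2_norm_nonneg by auto
  have "L2_set (\<lambda>n. cmod (twist t (dirichlet_mult a b) n)) {..<M} \<le> sqrt C * ?A * ?B" for M
  proof -
    have "(\<Sum>n<M. (cmod (twist t (dirichlet_mult a b) n))\<^sup>2) =
        (\<Sum>n\<in>{1..<M}. (cmod (twist t (dirichlet_mult a b) n))\<^sup>2)"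
      by (rule sum.mono_neutral_right) (auto simp: not_less_eq_eq Suc_le_eq)
    also have "\<dots> \<le> (\<Sum>n\<in>{1..<M}. C * (\<Sum>d | d dvd n. f d * g (n div d)))"
      by (intro sum_mono term_le) auto
    also have "\<dots> \<le> C * ((\<Sum>d<M. f d) * (\<Sum>e<M. g e))"
      unfolding sum_distrib_left[symmetric]
      using C by (intro mult_left_mono sum_divisors_convolution_le) (auto simp: f_def g_def)
    also have "\<dots> \<le> C * (?A\<^sup>2 * ?B\<^sup>2)"
    proof (intro mult_left_mono mult_mono)
      show "(\<Sum>d<M. f d) \<le> ?A\<^sup>2" "(\<Sum>d<M. g d) \<le> ?B\<^sup>2"
        using H2_L2_set_le[OF a, of "{..<M}"] H2_L2_set_le[OF b, of "{..<M}"]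
        by (simp_all add: f_def g_def L2_set_def real_le_rsqrt sqrt_le_D)
    qed (use C in \<open>auto simp: f_def g_def intro: sum_nonneg\<close>)
    also have "\<dots> = (sqrt C * ?A * ?B)\<^sup>2" using C by (simp add: power_mult_distrib)
    finally show ?thesis
      unfolding L2_set_def using AB C by (intro real_le_lsqrt) auto
  qed
  from H2_I[OF _ this] show "twist t (dirichlet_mult a b) \<in> H2"
    "H2_norm (twist t (dirichlet_mult a b)) \<le> sqrt C * ?A * ?B" by simp_all
qed

lemma dirichlet_mult_bound:
  obtains C where "C > 0"
    "\<And>a b. a \<in> H_plus \<Longrightarrow> b \<in> H_plus \<Longrightarrow>
       twist (1 / real (Suc k)) (dirichlet_mult a b) \<in> H2 \<and>
       H_plus_seminorm (Suc k) (dirichlet_mult a b)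
         \<le> C * H_plus_seminorm (Suc (2 * k + 1)) a * H_plus_seminorm (Suc (2 * k + 1)) b"
proof -
  define t where "t = 1 / real (Suc k)"
  have t: "t > 0" by (simp add: t_def)
  \<comment> \<open>Halving 1/(k+1) gives 1/(2k+2); in the shifted numbering that is index 2k +
    1.\<close>
  have t2: "t / 2 = 1 / real (Suc (2 * k + 1))" by (simp add: t_def field_simps)
  obtain C where C: "C > 0" "\<And>n. n > 0 \<Longrightarrow> real (card {d. d dvd n}) \<le> C * real n powr t"
    using card_divisors_le_powr[OF t] by blast
  show thesis
  proof (rule that)
    show "sqrt C > 0" using C(1) by simp
    fix a b assume "a \<in> H_plus" "b \<in> H_plus"
    then have "twist (t / 2) a \<in> H2" "twist (t / 2) b \<in> H2" using t by (auto intro: H_plus_twist)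
    then have "twist t (dirichlet_mult a b) \<in> H2 \<and> H2_norm (twist t (dirichlet_mult a b))
        \<le> sqrt C * H2_norm (twist (t / 2) a) * H2_norm (twist (t / 2) b)"
      by (intro conjI twist_dirichlet_mult) (use C in auto)
    then show "twist (1 / real (Suc k)) (dirichlet_mult a b) \<in> H2 \<and>
       H_plus_seminorm (Suc k) (dirichlet_mult a b)
         \<le> sqrt C * H_plus_seminorm (Suc (2 * k + 1)) a * H_plus_seminorm (Suc (2 * k + 1)) b"
      unfolding H_plus_seminorm_twist t2 unfolding t_def .
  qed
qed

lemma dirichlet_mult_H_plus:
  assumes "a \<in> H_plus" "b \<in> H_plus"
  shows "dirichlet_mult a b \<in> H_plus"
  unfolding H_plus_iff
proof (intro conjI allI)
  show "dirichlet_mult a b 0 = 0" by (simp add: dirichlet_mult_def)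
  show "twist (1 / real (Suc k)) (dirichlet_mult a b) \<in> H2" for k
    using dirichlet_mult_bound[of k] assms by metis
qed

text \<open>For n > 0 both sides sum over factorisations n = e f g; the bijection exchanges the pair
  (ef, e) for (e, f). At 0 both are sums over infinite sets, hence 0.\<close>

lemma dirichlet_mult_assoc: "dirichlet_mult (dirichlet_mult a b) c = dirichlet_mult a (dirichlet_mult b c)"
proof
  fix n
  show "dirichlet_mult (dirichlet_mult a b) c n = dirichlet_mult a (dirichlet_mult b c) n"
  proof (cases "n = 0")
    case True
    then show ?thesis by (simp add: dirichlet_mult_def)
  next
    case False
    have fin: "finite {d. d dvd m}" if "m dvd n" for m
      using False that by (metis dvd_0_left finite_divisors_nat gr0I)
    have fin': "finite {e. e dvd n div d}" if "d dvd n" for d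
      using fin[of "n div d"] that by (metis dvd_div_mult_self dvd_triv_left)
    have "dirichlet_mult (dirichlet_mult a b) c n =
        (\<Sum>(d, e)\<in>(SIGMA d:{d. d dvd n}. {e. e dvd d}). a e * b (d div e) * c (n div d))"
      unfolding dirichlet_mult_def sum_distrib_right using fin by (subst sum.Sigma) auto
    also have "\<dots> = (\<Sum>(e, f)\<in>(SIGMA e:{e. e dvd n}. {f. f dvd n div e}). a e * (b f * c (n div e div f)))"
    proof (rule sum.reindex_bij_witness[where i = "\<lambda>(e, f). (e * f, e)" and j = "\<lambda>(d, e). (e, d div e)"])
      fix x assume "x \<in> (SIGMA d:{d. d dvd n}. {e. e dvd d})"
      then obtain d e where x: "x = (d, e)" "d dvd n" "e dvd d" by auto
      then obtain f g where fg: "d = e * f" "n = e * f * g" by (metis dvdE)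
      have e: "e > 0" "f > 0" using fg False by (auto intro: Nat.gr0I)
      show "(case case x of (d, e) \<Rightarrow> (e, d div e) of (e, f) \<Rightarrow> (e * f, e)) = x"
        using x fg e by simp
      show "(case x of (d, e) \<Rightarrow> (e, d div e)) \<in> (SIGMA e:{e. e dvd n}. {f. f dvd n div e})"
        using x fg e by (simp add: mult.assoc)
      show "(case case x of (d, e) \<Rightarrow> (e, d div e) of (e, f) \<Rightarrow> a e * (b f * c (n div e div f))) =
          (case x of (d, e) \<Rightarrow> a e * b (d div e) * c (n div d))"
        using x(1) fg by (simp add: mult.assoc div_mult2_eq)
    next
      fix y assume "y \<in> (SIGMA e:{e. e dvd n}. {f. f dvd n div e})"
      then obtain e f where y: "y = (e, f)" "e dvd n" "f dvd n div e" by auto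
      then obtain g where "n = e * (f * g)" by (metis dvdE dvd_mult_div_cancel)
      then show "(case case y of (e, f) \<Rightarrow> (e * f, e) of (d, e) \<Rightarrow> (e, d div e)) = y"
        "(case y of (e, f) \<Rightarrow> (e * f, e)) \<in> (SIGMA d:{d. d dvd n}. {e. e dvd d})"
        using y(1) False by auto
    qed
    also have "\<dots> = dirichlet_mult a (dirichlet_mult b c) n"
      unfolding dirichlet_mult_def sum_distrib_left using fin fin' by (subst sum.Sigma) auto
    finally show ?thesis .
  qed
qed

lemma dirichlet_mult_add_left: "dirichlet_mult (a + b) c = dirichlet_mult a c + dirichlet_mult b c"
  and dirichlet_mult_add_right: "dirichlet_mult a (b + c) = dirichlet_mult a b + dirichlet_mult a c"
  and dirichlet_mult_diff_left: "dirichlet_mult (a - b) c = dirichlet_mult a c - dirichlet_mult b c"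
  and dirichlet_mult_diff_right: "dirichlet_mult a (b - c) = dirichlet_mult a b - dirichlet_mult a c"
  and dirichlet_mult_scale_left: "dirichlet_mult (dirichlet_scale s a) b = dirichlet_scale s (dirichlet_mult a b)"
  and dirichlet_mult_scale_right: "dirichlet_mult a (dirichlet_scale s b) = dirichlet_scale s (dirichlet_mult a b)"
  by (simp_all add: fun_eq_iff dirichlet_mult_def dirichlet_scale_def ring_distribs sum.distrib
      sum_subtractf sum_distrib_left mult_ac)

lemma frechet_algebra_H_plus: "frechet_algebra dirichlet_scale H_plus_topology dirichlet_mult"
proof -
  have "continuous_map (prod_topology HP.T HP.T) HP.T (\<lambda>(x, y). dirichlet_mult x y)"
  proof (rule HP.continuous_map_bilinear)
    show "\<exists>m C. C > 0 \<and> (\<forall>x\<in>H_plus. \<forall>y\<in>H_plus.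
        H_plus_seminorm (Suc k) (dirichlet_mult x y) \<le> C * H_plus_seminorm (Suc m) x * H_plus_seminorm (Suc m) y)" for k
      using dirichlet_mult_bound[of k] by metis
  qed (auto simp: dirichlet_mult_H_plus dirichlet_mult_diff_left dirichlet_mult_diff_right)
  then show ?thesis
    unfolding frechet_algebra_def T_eq_H_plus_topology
    by (simp add: frechet_space_H_plus dirichlet_mult_H_plus dirichlet_mult_assoc dirichlet_mult_add_left
        dirichlet_mult_add_right dirichlet_mult_scale_left dirichlet_mult_scale_right)
qed

section \<open>Schauder bases\<close>

lemma sum_fun_at: "(\<Sum>i\<in>A. f i) x = (\<Sum>i\<in>A. f i x)"
  by (induction A rule: infinite_finite_induct) auto

text \<open>The bound does not depend on k because all weights are at most 1; it also places finite
  sums of monomials in the space.\<close>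

lemma finite_support_H_plus:
  assumes S: "finite S" "0 \<notin> S" and a: "\<And>n. n \<notin> S \<Longrightarrow> a n = 0"
  shows "a \<in> H_plus" and "H_plus_seminorm (Suc k) a \<le> L2_set (\<lambda>n. cmod (a n)) S"
proof -
  have L2: "L2_set (\<lambda>n. cmod (twist (1 / real (Suc k)) a n)) {..<M} \<le> L2_set (\<lambda>n. cmod (a n)) S" for M k
  proof -
    have "cmod (twist (1 / real (Suc k)) a n) \<le> cmod (a n)" for n
    proof (cases "n = 0")
      case False
      then have "real n powr (- (1 / real (Suc k))) \<le> real n powr 0" by (intro powr_mono) auto
      then show ?thesis using False by (simp add: cmod_twist mult_left_le)
    qed simp
    then have "L2_set (\<lambda>n. cmod (twist (1 / real (Suc k)) a n)) {..<M} \<le> L2_set (\<lambda>n. cmod (a n)) {..<M}"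
      by (intro L2_set_mono) auto
    also have "\<dots> = L2_set (\<lambda>n. cmod (a n)) ({..<M} \<inter> S)"
      unfolding L2_set_def using a by (intro arg_cong[of _ _ sqrt] sum.mono_neutral_right) auto
    also have "\<dots> \<le> L2_set (\<lambda>n. cmod (a n)) S"
      unfolding L2_set_def using S by (intro real_sqrt_le_mono sum_mono2) auto
    finally show ?thesis .
  qed
  show "a \<in> H_plus"
    unfolding H_plus_iff using a[OF S(2)] H2_I(1)[OF twist_zero L2] by blast
  show "H_plus_seminorm (Suc k) a \<le> L2_set (\<lambda>n. cmod (a n)) S"
    unfolding H_plus_seminorm_twist by (rule H2_I(2)[OF twist_zero L2])
qed

lemma dirichlet_monomial_H_plus: "n > 0 \<Longrightarrow> dirichlet_monomial n \<in> H_plus"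
  by (rule finite_support_H_plus(1)[of "{n}"]) (auto simp: dirichlet_monomial_def)

lemma sum_scale_monomial:
  assumes "finite A"
  shows "(\<Sum>n\<in>A. dirichlet_scale (c n) (dirichlet_monomial (f n))) m = (\<Sum>n | n \<in> A \<and> f n = m. c n)"
proof -
  have "(\<Sum>n\<in>A. dirichlet_scale (c n) (dirichlet_monomial (f n))) m = (\<Sum>n\<in>A. if f n = m then c n else 0)"
    unfolding sum_fun_at by (intro sum.cong) (auto simp: dirichlet_scale_def dirichlet_monomial_def)
  also have "\<dots> = (\<Sum>n | n \<in> A \<and> f n = m. c n)"
    using assms by (simp add: sum.If_cases Int_def)
  finally show ?thesis .
qed

lemma sum_scale_monomial_inj:
  assumes "finite A" "inj_on f A" "n \<in> A"
  shows "(\<Sum>n\<in>A. dirichlet_scale (c n) (dirichlet_monomial (f n))) (f n) = c n"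
proof -
  have "{i. i \<in> A \<and> f i = f n} = {n}" using assms(2,3) by (auto dest: inj_onD)
  then show ?thesis by (simp add: sum_scale_monomial[OF assms(1)])
qed

lemma sum_scale_monomial_outside:
  assumes "finite A" "m \<notin> f ` A"
  shows "(\<Sum>n\<in>A. dirichlet_scale (c n) (dirichlet_monomial (f n))) m = 0"
proof -
  have "{i. i \<in> A \<and> f i = m} = {}" using assms(2) by auto
  then show ?thesis unfolding sum_scale_monomial[OF assms(1)] by (simp only: sum.empty)
qed

lemma sum_scale_monomial_H_plus:
  assumes "finite A" "0 \<notin> f ` A"
  shows "(\<Sum>n\<in>A. dirichlet_scale (c n) (dirichlet_monomial (f n))) \<in> H_plus"
  using assms sum_scale_monomial_outside[OF assms(1)]
  by (intro finite_support_H_plus(1)[of "f ` A"]) auto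

section \<open>Expansions in Dirichlet monomials\<close>

text \<open>The reindexing \<pi> lets one criterion serve the basis (identity) and its permutations.
  \<open>Suc\<close> aligns sequences starting at 0 with monomials starting at n = 1.\<close>

lemma expansion_monomials_iff:
  "expansion dirichlet_scale H_plus_topology (\<lambda>n. dirichlet_monomial (Suc (\<pi> n))) c x \<longleftrightarrow>
    x \<in> H_plus \<and> (\<forall>k. (\<lambda>N. H_plus_seminorm (Suc k)
      ((\<Sum>n<N. dirichlet_scale (c n) (dirichlet_monomial (Suc (\<pi> n)))) - x)) \<longlonglongrightarrow> 0)"
proof -
  have "range (\<lambda>N. \<Sum>n<N. dirichlet_scale (c n) (dirichlet_monomial (Suc (\<pi> n)))) \<subseteq> H_plus"
    by (auto intro!: sum_scale_monomial_H_plus)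
  then show ?thesis
    unfolding expansion_def T_eq_H_plus_topology[symmetric] by (rule HP.limitin_T_iff)
qed

text \<open>Once N > n, the coordinate \<open>Suc n\<close> of the N-th partial sum is constantly
  \<open>c n\<close>, and coordinates are continuous.\<close>

lemma expansion_monomials_coeff:
  assumes "expansion dirichlet_scale H_plus_topology (\<lambda>n. dirichlet_monomial (Suc n)) c x"
  shows "c n = x (Suc n)"
proof -
  define S where "S = (\<lambda>N. \<Sum>n<N. dirichlet_scale (c n) (dirichlet_monomial (Suc n)))"
  have x: "x \<in> H_plus" and lim: "(\<lambda>N. H_plus_seminorm (Suc 0) (S N - x)) \<longlonglongrightarrow> 0"
    using assms expansion_monomials_iff[of "\<lambda>n. n" c x] unfolding S_def by auto
  have S: "S N \<in> H_plus" for N unfolding S_def by (rule sum_scale_monomial_H_plus) auto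
  have "eventually (\<lambda>N. norm (c n - x (Suc n)) \<le>
      real (Suc n) powr (1 / real (Suc 0)) * H_plus_seminorm (Suc 0) (S N - x)) sequentially"
    using eventually_gt_at_top[of n]
  proof eventually_elim
    case (elim N)
    then have "S N (Suc n) = c n"
      unfolding S_def by (intro sum_scale_monomial_inj) auto
    then show ?case using cmod_coord_le[OF HP.E_diff[OF S[of N] x], of "Suc n" 0] by simp
  qed
  moreover have "(\<lambda>N. real (Suc n) powr (1 / real (Suc 0)) * H_plus_seminorm (Suc 0) (S N - x)) \<longlonglongrightarrow> 0"
    using tendsto_mult_left[OF lim] by simp
  ultimately have "(\<lambda>N. c n - x (Suc n)) \<longlonglongrightarrow> 0" by (rule Lim_null_comparison)
  then show ?thesis by (simp add: LIMSEQ_const_iff)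
qed

text \<open>The remainder after N terms is x with the coordinates already used set to 0. The
  identity permutation gives existence for the Schauder basis, a general one
  unconditionality.\<close>

lemma expansion_monomials_permuted:
  assumes x: "x \<in> H_plus" and \<pi>: "bij \<pi>"
  shows "expansion dirichlet_scale H_plus_topology (\<lambda>n. dirichlet_monomial (Suc (\<pi> n))) (\<lambda>n. x (Suc (\<pi> n))) x"
  unfolding expansion_monomials_iff
proof (intro conjI allI x)
  fix k
  define t where "t = 1 / real (Suc k)"
  define P where "P = (\<lambda>N. \<Sum>n<N. dirichlet_scale (x (Suc (\<pi> n))) (dirichlet_monomial (Suc (\<pi> n))))"
  define S where "S = (\<lambda>N. (\<lambda>n. Suc (\<pi> n)) ` {..<N})"
  have x0: "x 0 = 0" using x by (simp add: H_plus_def)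
  have "twist t (x - P N) = (\<lambda>n. if n \<in> S N then 0 else twist t x n)" for N
  proof
    fix m
    show "twist t (x - P N) m = (if m \<in> S N then 0 else twist t x m)"
    proof (cases "m \<in> S N")
      case True
      then obtain n where n: "n < N" "m = Suc (\<pi> n)" by (auto simp: S_def)
      have "inj_on (\<lambda>n. Suc (\<pi> n)) {..<N}" using bij_is_inj[OF \<pi>] by (auto simp: inj_on_def)
      then have "P N m = x m"
        unfolding P_def n(2) using n(1) by (intro sum_scale_monomial_inj) auto
      then show ?thesis using True by (simp add: twist_def)
    next
      case False
      then have "P N m = 0" unfolding P_def S_def by (intro sum_scale_monomial_outside) auto
      then show ?thesis using False by (simp add: twist_def)
    qed
  qed
  \<comment> \<open>Index 0 is never of the form \<open>Suc (\<pi> n)\<close>, but the tail lemma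
    wants every index covered eventually; inserting it changes nothing, as \<open>twist\<close>
    vanishes there.\<close>
  moreover have "(\<lambda>N. H2_norm (\<lambda>n. if n \<in> insert 0 (S N) then 0 else twist t x n)) \<longlonglongrightarrow> 0"
  proof (rule H2_tail_tendsto_zero)
    show "twist t x \<in> H2" using x by (intro H_plus_twist) (simp_all add: t_def)
    show "finite (insert 0 (S N))" for N by (simp add: S_def)
    show "eventually (\<lambda>N. n \<in> insert 0 (S N)) sequentially" for n
    proof (cases n)
      case (Suc m)
      obtain i where "m = \<pi> i" using bij_is_surj[OF \<pi>] by (metis surjD)
      then have "n \<in> insert 0 (S N)" if "i < N" for N using Suc that by (auto simp: S_def)
      then show ?thesis by (rule eventually_mono[OF eventually_gt_at_top[of i]])
    qed simp
  qed
  moreover have "(\<lambda>n. if n \<in> insert 0 (S N) then 0 else twist t x n) = (\<lambda>n. if n \<in> S N then 0 else twist t x n)" for N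
    by (auto simp: fun_eq_iff)
  ultimately have "(\<lambda>N. H_plus_seminorm (Suc k) (x - P N)) \<longlonglongrightarrow> 0"
    by (simp add: H_plus_seminorm_twist t_def)
  moreover have "P N \<in> H_plus" for N unfolding P_def by (rule sum_scale_monomial_H_plus) auto
  ultimately show "(\<lambda>N. H_plus_seminorm (Suc k) (P N - x)) \<longlonglongrightarrow> 0"
    using HP.p_minus_commute[OF x] by simp
qed

lemma schauder_basis_monomials:
  "schauder_basis dirichlet_scale H_plus_topology (\<lambda>n. dirichlet_monomial (Suc n))"
  unfolding schauder_basis_def
proof (intro conjI ballI)
  show "range (\<lambda>n. dirichlet_monomial (Suc n)) \<subseteq> topspace H_plus_topology"
    by (auto intro: dirichlet_monomial_H_plus)
  fix x assume "x \<in> topspace H_plus_topology"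
  then have "expansion dirichlet_scale H_plus_topology (\<lambda>n. dirichlet_monomial (Suc n)) (\<lambda>n. x (Suc n)) x"
    using expansion_monomials_permuted[of x "\<lambda>n. n"] by (simp add: bij_def)
  then show "\<exists>!c. expansion dirichlet_scale H_plus_topology (\<lambda>n. dirichlet_monomial (Suc n)) c x"
    by (rule ex1I[of _ "\<lambda>n. x (Suc n)"]) (simp add: fun_eq_iff expansion_monomials_coeff)
qed

lemma unconditional_basis_monomials:
  "unconditional_basis dirichlet_scale H_plus_topology (\<lambda>n. dirichlet_monomial (Suc n))"
  unfolding unconditional_basis_def
proof (intro conjI ballI allI impI schauder_basis_monomials)
  fix x c and \<pi> :: "nat \<Rightarrow> nat"
  assume x: "x \<in> topspace H_plus_topology"
    and c: "expansion dirichlet_scale H_plus_topology (\<lambda>n. dirichlet_monomial (Suc n)) c x"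
    and \<pi>: "bij \<pi>"
  have "c = (\<lambda>n. x (Suc n))" using expansion_monomials_coeff[OF c] by blast
  then have "expansion dirichlet_scale H_plus_topology ((\<lambda>n. dirichlet_monomial (Suc n)) \<circ> \<pi>) (c \<circ> \<pi>) x"
    using expansion_monomials_permuted[OF _ \<pi>, of x] x by (simp add: comp_def)
  then show "\<exists>z. expansion dirichlet_scale H_plus_topology ((\<lambda>n. dirichlet_monomial (Suc n)) \<circ> \<pi>) (c \<circ> \<pi>) z"
    by blast
qed

section \<open>Failure of absoluteness\<close>

lemma harm_unbounded: "\<exists>M. B < (harm M :: real)"
proof -
  have "eventually (\<lambda>n. B < harm n) sequentially"
    using harm_at_top unfolding filterlim_at_top_dense by blast
  then show ?thesis by (auto dest: eventually_happens)
qed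

text \<open>With \<open>x = (\<Sum>n\<le>M. n\<^sup>-\<^sup>1\<^sup>/\<^sup>2 e\<^sub>n)\<close> and the seminorm of weight \<open>n\<^sup>-\<^sup>1\<^sup>/\<^sup>2\<close>, absoluteness would bound the
  harmonic number \<open>H\<^sub>M\<close> by a multiple of its square root.\<close>

lemma not_absolute_basis_monomials:
  "\<not> absolute_basis dirichlet_scale H_plus_topology (\<lambda>n. dirichlet_monomial (Suc n))"
proof
  let ?e = "\<lambda>n. dirichlet_monomial (Suc n)" and ?p = "H_plus_seminorm (Suc (Suc 0))"
  assume "absolute_basis dirichlet_scale H_plus_topology ?e"
  moreover have "continuous_seminorm dirichlet_scale H_plus_topology ?p"
    unfolding T_eq_H_plus_topology[symmetric] by (rule HP.continuous_seminorm_p)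
  ultimately obtain q C where q: "continuous_seminorm dirichlet_scale H_plus_topology q" "C > 0"
    and abs: "\<And>x c. x \<in> H_plus \<Longrightarrow> expansion dirichlet_scale H_plus_topology ?e c x \<Longrightarrow>
      summable (\<lambda>n. cmod (c n) * ?p (?e n)) \<and> (\<Sum>n. cmod (c n) * ?p (?e n)) \<le> C * q x"
    unfolding absolute_basis_def topspace_H_plus by meson
  obtain k D where D: "D > 0" "\<And>x. x \<in> H_plus \<Longrightarrow> q x \<le> D * H_plus_seminorm (Suc k) x"
    using HP.continuous_seminorm_bound[of q] q(1) unfolding T_eq_H_plus_topology by blast
  have bound: "harm M \<le> (C * D)\<^sup>2" for M
  proof -
    define x :: "nat \<Rightarrow> complex" where "x = (\<lambda>n. if n \<in> {1..M} then of_real (real n powr (- (1 / 2))) else 0)"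
    \<comment> \<open>The index k comes from the unknown q; the unweighted norm eliminates it and
      equals the square root of \<open>harm M\<close>.\<close>
    have x: "x \<in> H_plus" "H_plus_seminorm (Suc k) x \<le> L2_set (\<lambda>n. cmod (x n)) {1..M}"
      using finite_support_H_plus(1)[of "{1..M}" x] finite_support_H_plus(2)[of "{1..M}" x k]
      by (auto simp: x_def)
    have ex: "expansion dirichlet_scale H_plus_topology ?e (\<lambda>n. x (Suc n)) x"
      using expansion_monomials_permuted[OF x(1), of "\<lambda>n. n"] by (simp add: bij_def)
    note sm = abs[OF x(1) ex]
    have sq: "(real n powr (- (1 / 2))) * (real n powr (- (1 / 2))) = inverse (real n)" for n
      unfolding powr_add[symmetric] by (simp add: powr_minus)
    have pe: "real (Suc n) powr (- (1 / 2)) \<le> ?p (?e n)" for n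
    proof -
      have "cmod (twist (1 / real (Suc (Suc 0))) (?e n) (Suc n)) \<le> ?p (?e n)"
        unfolding H_plus_seminorm_twist by (intro H2_coord_le H_plus_twist dirichlet_monomial_H_plus) auto
      then show ?thesis by (simp add: cmod_twist dirichlet_monomial_def)
    qed
    have "harm M = (\<Sum>n<M. inverse (real (Suc n)))"
      by (simp add: harm_def sum.atLeast1_atMost_eq)
    also have "\<dots> \<le> (\<Sum>n<M. cmod (x (Suc n)) * ?p (?e n))"
    proof (rule sum_mono)
      fix n assume "n \<in> {..<M}"
      then have "cmod (x (Suc n)) = real (Suc n) powr (- (1 / 2))" by (simp add: x_def)
      then show "inverse (real (Suc n)) \<le> cmod (x (Suc n)) * ?p (?e n)"
        using mult_left_mono[OF pe[of n], of "real (Suc n) powr (- (1 / 2))"]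
        unfolding sq by (simp only: powr_ge_zero)
    qed
    also have "\<dots> \<le> (\<Sum>n. cmod (x (Suc n)) * ?p (?e n))"
      using sm HP.p_nonneg[OF dirichlet_monomial_H_plus[of "Suc _"], of _ 1]
      by (intro sum_le_suminf) auto
    also have "\<dots> \<le> C * (D * L2_set (\<lambda>n. cmod (x n)) {1..M})"
    proof -
      have "C * q x \<le> C * (D * H_plus_seminorm (Suc k) x)"
        using D(2)[OF x(1)] q(2) by (intro mult_left_mono) auto
      also have "\<dots> \<le> C * (D * L2_set (\<lambda>n. cmod (x n)) {1..M})"
        using x(2) q(2) D(1) by (intro mult_left_mono) auto
      finally show ?thesis using sm by linarith
    qed
    also have "L2_set (\<lambda>n. cmod (x n)) {1..M} = sqrt (harm M)"
      unfolding L2_set_def harm_def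
      by (intro arg_cong[of _ _ sqrt] sum.cong) (auto simp: x_def power2_eq_square sq)
    finally have le: "sqrt (harm M) * sqrt (harm M) \<le> (C * D) * sqrt (harm M)"
      by (simp add: harm_nonneg mult.assoc)
    \<comment> \<open>The factor \<open>sqrt (harm M)\<close> can be cancelled only when it is
      positive; otherwise the left side is 0.\<close>
    have "sqrt (harm M) \<le> C * D"
    proof (cases "harm M = (0::real)")
      case False
      then have "0 < sqrt (harm M)" by (metis harm_nonneg order_less_le real_sqrt_gt_zero)
      then show ?thesis by (rule mult_right_le_imp_le[OF le])
    qed (use q(2) D(1) in simp)
    then show ?thesis by (rule sqrt_le_D)
  qed
  obtain M where "(C * D)\<^sup>2 < harm M" using harm_unbounded by blast
  with bound[of M] show False by linarith
qed

section \<open>Failure of nuclearity\<close>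

text \<open>Duality of \<open>\<ell>\<^sup>2\<close>: testing \<open>y\<close> on the vector with the conjugate coefficients.\<close>

lemma functional_L2_bound:
  assumes add: "\<And>x x'. x \<in> H_plus \<Longrightarrow> x' \<in> H_plus \<Longrightarrow> y (x + x') = y x + y x'"
    and scale: "\<And>a x. x \<in> H_plus \<Longrightarrow> y (dirichlet_scale a x) = a * y x"
    and bound: "\<And>x. x \<in> H_plus \<Longrightarrow> cmod (y x) \<le> B * H_plus_seminorm (Suc k) x" and B: "B \<ge> 0"
  shows "L2_set (\<lambda>n. cmod (y (dirichlet_monomial n))) {1..M} \<le> B"
proof -
  define L where "L = L2_set (\<lambda>n. cmod (y (dirichlet_monomial n))) {1..M}"
  define b where "b = (\<lambda>n. cnj (y (dirichlet_monomial n)))"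
  define z where "z = (\<lambda>A. \<Sum>n\<in>A. dirichlet_scale (b n) (dirichlet_monomial n))"
  have z: "z A \<in> H_plus" if "finite A" "0 \<notin> A" for A
    unfolding z_def using that by (intro sum_scale_monomial_H_plus) auto
  have y0: "y 0 = 0"
    using scale[of 0 0] by (simp add: dirichlet_scale_def zero_fun_def[symmetric])
  have yz: "y (z A) = (\<Sum>n\<in>A. b n * y (dirichlet_monomial n))" if "finite A" "0 \<notin> A" for A
    using that
  proof (induction A rule: finite_induct)
    case (insert n A)
    have m: "dirichlet_monomial n \<in> H_plus" using insert by (intro dirichlet_monomial_H_plus) auto
    have "z (insert n A) = dirichlet_scale (b n) (dirichlet_monomial n) + z A"
      using insert by (simp add: z_def)
    then have "y (z (insert n A)) = y (dirichlet_scale (b n) (dirichlet_monomial n)) + y (z A)"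
      using add HP.E_scale[OF m] z insert by simp
    then show ?case using insert scale[OF m] by simp
  qed (simp add: z_def y0)
  have "b n * y (dirichlet_monomial n) = of_real ((cmod (y (dirichlet_monomial n)))\<^sup>2)" for n
    unfolding b_def complex_norm_square by (rule mult.commute)
  then have "y (z {1..M}) = of_real (\<Sum>n\<in>{1..M}. (cmod (y (dirichlet_monomial n)))\<^sup>2)"
    by (simp add: yz)
  also have "(\<Sum>n\<in>{1..M}. (cmod (y (dirichlet_monomial n)))\<^sup>2) = L\<^sup>2"
    by (simp add: L_def L2_set_def sum_nonneg)
  finally have "cmod (y (z {1..M})) = L\<^sup>2" by (simp add: norm_power)
  then have "L\<^sup>2 \<le> B * H_plus_seminorm (Suc k) (z {1..M})"
    using bound[OF z[of "{1..M}"]] by simp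
  \<comment> \<open>Here k disappears: the test vector has finite support, so its unweighted norm L
    bounds the seminorm, and L^2 \<le> B L remains.\<close>
  also have "H_plus_seminorm (Suc k) (z {1..M}) \<le> L2_set (\<lambda>n. cmod (z {1..M} n)) {1..M}"
    unfolding z_def using sum_scale_monomial_outside[of "{1..M}" _ "\<lambda>n. n" b]
    by (intro finite_support_H_plus(2)) auto
  also have "\<dots> = L"
    unfolding L_def
  proof (rule L2_set_cong)
    fix n assume "n \<in> {1..M}"
    then have "z {1..M} n = b n"
      unfolding z_def using sum_scale_monomial_inj[of "{1..M}" "\<lambda>n. n" n b] by simp
    then show "cmod (z {1..M} n) = cmod (y (dirichlet_monomial n))" by (simp add: b_def)
  qed simp
  finally have "L * L \<le> B * L" using B by (simp add: power2_eq_square mult_left_mono)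
  moreover have "L \<ge> 0" by (simp add: L_def)
  ultimately show ?thesis using B unfolding L_def[symmetric] by (cases "L = 0") auto
qed

text \<open>Trace argument: the coordinates of \<open>e\<^sub>n = (\<Sum>j. y\<^sub>j(e\<^sub>n) u\<^sub>j)\<close> at \<open>n\<close>, summed with the weights \<open>1/n\<close>
  of the seminorm \<open>p\<close>, would bound the harmonic series by \<open>(\<Sum>j. \<parallel>y\<^sub>j\<parallel> \<parallel>u\<^sub>j\<parallel>)\<close>.\<close>

lemma harm_le_nuclear_sum:
  fixes y :: "nat \<Rightarrow> (nat \<Rightarrow> complex) \<Rightarrow> complex" and u :: "nat \<Rightarrow> nat \<Rightarrow> nat \<Rightarrow> complex"
  assumes L2: "\<And>j. L2_set (\<lambda>n. cmod (y j (dirichlet_monomial n))) {1..M} \<le> B j"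
    and u: "\<And>j k. u j k \<in> H_plus"
  shows "(\<Sum>n\<in>{1..M}. inverse (real n) *
      (1 - real n * H_plus_seminorm (Suc 0) (dirichlet_monomial n - (\<Sum>j<N. dirichlet_scale (y j (dirichlet_monomial n)) (u j k)))))
    \<le> (\<Sum>j<N. B j * H_plus_seminorm (Suc 0) (u j k))"
proof -
  have "(\<Sum>n\<in>{1..M}. inverse (real n) *
      (1 - real n * H_plus_seminorm (Suc 0) (dirichlet_monomial n - (\<Sum>j<N. dirichlet_scale (y j (dirichlet_monomial n)) (u j k)))))
    \<le> (\<Sum>n\<in>{1..M}. \<Sum>j<N. cmod (y j (dirichlet_monomial n)) * cmod (twist 1 (u j k) n))"
  proof (rule sum_mono)
    fix n assume n: "n \<in> {1..M}"
    let ?e = "dirichlet_monomial n"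
    define R where "R = (\<Sum>j<N. dirichlet_scale (y j ?e) (u j k))"
    have e: "?e \<in> H_plus" using n by (intro dirichlet_monomial_H_plus) auto
    have R: "R \<in> H_plus" unfolding R_def using u by (intro HP.subspace_sum HP.subspace_E HP.E_scale)
    \<comment> \<open>The diagonal entry 1 is shared between remainder and finite-rank part. The
      coordinate estimate charges the remainder a factor n; division by n then turns coordinates of
      \<open>u j k\<close> into those of \<open>twist 1 (u j k)\<close>.\<close>
    have "1 = (?e - R) n + R n" by (simp add: dirichlet_monomial_def)
    then have "1 \<le> cmod ((?e - R) n) + cmod (R n)" by (metis norm_one norm_triangle_ineq)
    moreover have "cmod ((?e - R) n) \<le> real n * H_plus_seminorm (Suc 0) (?e - R)"
      using cmod_coord_le[OF HP.E_diff[OF e R], of n 0] by simp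
    moreover have "cmod (R n) \<le> (\<Sum>j<N. cmod (y j ?e) * cmod (u j k n))"
      unfolding R_def sum_fun_at by (rule sum_norm_le) (simp add: dirichlet_scale_def norm_mult)
    ultimately have "1 - real n * H_plus_seminorm (Suc 0) (?e - R) \<le> (\<Sum>j<N. cmod (y j ?e) * cmod (u j k n))"
      by linarith
    then have "inverse (real n) * (1 - real n * H_plus_seminorm (Suc 0) (?e - R))
        \<le> inverse (real n) * (\<Sum>j<N. cmod (y j ?e) * cmod (u j k n))"
      by (intro mult_left_mono) auto
    also have "\<dots> = (\<Sum>j<N. cmod (y j ?e) * cmod (twist 1 (u j k) n))"
      by (simp add: cmod_twist powr_minus sum_distrib_left mult_ac)
    finally show "inverse (real n) * (1 - real n * H_plus_seminorm (Suc 0) (?e - R))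
        \<le> (\<Sum>j<N. cmod (y j ?e) * cmod (twist 1 (u j k) n))" .
  qed
  \<comment> \<open>With j outside, Cauchy-Schwarz in n separates the norm of the functional from
    that of the vector.\<close>
  also have "\<dots> = (\<Sum>j<N. \<Sum>n\<in>{1..M}. cmod (y j (dirichlet_monomial n)) * cmod (twist 1 (u j k) n))"
    by (rule sum.swap)
  also have "\<dots> \<le> (\<Sum>j<N. B j * H_plus_seminorm (Suc 0) (u j k))"
  proof (rule sum_mono)
    fix j
    have "(\<Sum>n\<in>{1..M}. cmod (y j (dirichlet_monomial n)) * cmod (twist 1 (u j k) n))
        \<le> L2_set (\<lambda>n. cmod (y j (dirichlet_monomial n))) {1..M} * L2_set (\<lambda>n. cmod (twist 1 (u j k) n)) {1..M}"
      using L2_set_mult_ineq[of "\<lambda>n. cmod (y j (dirichlet_monomial n))" "\<lambda>n. cmod (twist 1 (u j k) n)" "{1..M}"]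
      by simp
    also have "\<dots> \<le> B j * H_plus_seminorm (Suc 0) (u j k)"
    proof (rule mult_mono[OF L2])
      show "L2_set (\<lambda>n. cmod (twist 1 (u j k) n)) {1..M} \<le> H_plus_seminorm (Suc 0) (u j k)"
        using H2_L2_set_le[OF H_plus_twist[OF u], of 1 "{1..M}"] by (simp add: H_plus_seminorm_twist)
      show "0 \<le> B j" using L2[of j] L2_set_nonneg order_trans by blast
    qed simp
    finally show "(\<Sum>n\<in>{1..M}. cmod (y j (dirichlet_monomial n)) * cmod (twist 1 (u j k) n))
        \<le> B j * H_plus_seminorm (Suc 0) (u j k)" .
  qed
  finally show ?thesis .
qed

text \<open>The target is the first seminorm, whose weights 1/n make the trace over the first M
  coordinates exactly \<open>harm M\<close>. The order of limits matters: k tends to infinity for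
  fixed N, then N for fixed M, so each passes through a finite sum over n; the final bound is free
  of M.\<close>

lemma not_nuclear_H_plus: "\<not> nuclear_space dirichlet_scale H_plus_topology"
proof
  let ?p = "H_plus_seminorm (Suc 0)" and ?e = dirichlet_monomial
  assume "nuclear_space dirichlet_scale H_plus_topology"
  then obtain q where q: "continuous_seminorm dirichlet_scale HP.T q"
      and nuc: "nuclear_canonical_map dirichlet_scale HP.T q ?p"
    using HP.continuous_seminorm_p[of 0] unfolding nuclear_space_def T_eq_H_plus_topology by blast
  obtain y c u where
        "\<forall>j. \<forall>x\<in>H_plus. \<forall>x'\<in>H_plus. y j (x + x') = y j x + y j x'"
        "\<forall>j a. \<forall>x\<in>H_plus. y j (dirichlet_scale a x) = a * y j x"
        "\<forall>j. 0 \<le> c j \<and> (\<forall>x\<in>H_plus. cmod (y j x) \<le> c j * q x)"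
        "\<forall>j. local_Cauchy HP.T ?p (u j)"
      and sm: "summable (\<lambda>j. c j * local_norm ?p (u j))"
      and "\<forall>x\<in>H_plus. (\<lambda>N. local_norm ?p (\<lambda>k. x - (\<Sum>j<N. dirichlet_scale (y j x) (u j k)))) \<longlonglongrightarrow> 0"
    using nuc unfolding nuclear_canonical_map_def HP.topspace_T by (elim exE conjE)
  then have add: "\<And>j x x'. x \<in> H_plus \<Longrightarrow> x' \<in> H_plus \<Longrightarrow> y j (x + x') = y j x + y j x'"
    and scale: "\<And>j a x. x \<in> H_plus \<Longrightarrow> y j (dirichlet_scale a x) = a * y j x"
    and c: "\<And>j. 0 \<le> c j" "\<And>j x. x \<in> H_plus \<Longrightarrow> cmod (y j x) \<le> c j * q x"
    and u: "\<And>j. local_Cauchy HP.T ?p (u j)"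
    and conv: "\<And>x. x \<in> H_plus \<Longrightarrow>
      (\<lambda>N. local_norm ?p (\<lambda>k. x - (\<Sum>j<N. dirichlet_scale (y j x) (u j k)))) \<longlonglongrightarrow> 0"
    by blast+
  have uE: "u j k \<in> H_plus" for j k using u by (auto simp: local_Cauchy_def)
  obtain m C where C: "C > 0" "\<And>x. x \<in> H_plus \<Longrightarrow> q x \<le> C * H_plus_seminorm (Suc m) x"
    using HP.continuous_seminorm_bound[OF q] by blast
  have ln: "local_norm ?p (u j) \<ge> 0" for j
    by (rule LIMSEQ_le_const[OF HP.local_Cauchy_convergent[OF u]]) (use HP.p_nonneg[OF uE] in auto)
  define S where "S = (\<Sum>j. c j * local_norm ?p (u j))"
  have "harm M \<le> C * S" for M
  proof -
    have L2: "L2_set (\<lambda>n. cmod (y j (?e n))) {1..M} \<le> c j * C" for j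
    proof (rule functional_L2_bound)
      show "cmod (y j x) \<le> c j * C * H_plus_seminorm (Suc m) x" if "x \<in> H_plus" for x
        using c(2)[OF that] mult_left_mono[OF C(2)[OF that] c(1)] by (metis mult.assoc order_trans)
      show "y j (x + x') = y j x + y j x'" if "x \<in> H_plus" "x' \<in> H_plus" for x x'
        using that by (rule add)
      show "y j (dirichlet_scale a x) = a * y j x" if "x \<in> H_plus" for a x
        using that by (rule scale)
      show "0 \<le> c j * C" using c(1) C(1) by simp
    qed
    define r where "r = (\<lambda>N n k. ?e n - (\<Sum>j<N. dirichlet_scale (y j (?e n)) (u j k)))"
    have e: "?e n \<in> H_plus" if "n \<in> {1..M}" for n using that by (intro dirichlet_monomial_H_plus) auto
    have le: "(\<Sum>n\<in>{1..M}. inverse (real n) * (1 - real n * local_norm ?p (r N n))) \<le> C * S" for N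
    proof -
      have "(\<Sum>n\<in>{1..M}. inverse (real n) * (1 - real n * local_norm ?p (r N n)))
          \<le> (\<Sum>j<N. c j * C * local_norm ?p (u j))"
      \<comment> \<open>The inequality holds for every representative index k; its limit replaces
        the seminorms of the representatives by local norms.\<close>
      proof (rule LIMSEQ_le)
        show "(\<lambda>k. \<Sum>n\<in>{1..M}. inverse (real n) * (1 - real n * ?p (r N n k)))
            \<longlonglongrightarrow> (\<Sum>n\<in>{1..M}. inverse (real n) * (1 - real n * local_norm ?p (r N n)))"
          unfolding r_def
          by (intro tendsto_intros HP.local_Cauchy_convergent HP.local_Cauchy_diff_sum u e)
        show "(\<lambda>k. \<Sum>j<N. c j * C * ?p (u j k)) \<longlonglongrightarrow> (\<Sum>j<N. c j * C * local_norm ?p (u j))"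
          by (intro tendsto_intros HP.local_Cauchy_convergent u)
        show "\<exists>K. \<forall>k\<ge>K. (\<Sum>n\<in>{1..M}. inverse (real n) * (1 - real n * ?p (r N n k)))
            \<le> (\<Sum>j<N. c j * C * ?p (u j k))"
          unfolding r_def
          by (intro exI[of _ 0] allI impI harm_le_nuclear_sum[where B = "\<lambda>j. c j * C"] L2 uE)
      qed
      also have "\<dots> = C * (\<Sum>j<N. c j * local_norm ?p (u j))"
        by (simp add: sum_distrib_left mult_ac)
      also have "\<dots> \<le> C * S"
        unfolding S_def using C(1) c(1) ln sm by (intro mult_left_mono sum_le_suminf) auto
      finally show ?thesis .
    qed
    \<comment> \<open>The factor n in front of the remainder is harmless: M is fixed, so each of the
      finitely many remainders tends to 0.\<close>
    have "(\<lambda>N. \<Sum>n\<in>{1..M}. inverse (real n) * (1 - real n * local_norm ?p (r N n)))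
        \<longlonglongrightarrow> (\<Sum>n\<in>{1..M}. inverse (real n) * (1 - real n * 0))"
      unfolding r_def by (intro tendsto_intros conv e)
    then have "(\<Sum>n\<in>{1..M}. inverse (real n) * (1 - real n * 0)) \<le> C * S"
      by (rule LIMSEQ_le_const2) (use le in blast)
    then show ?thesis by (simp add: harm_def)
  qed
  then show False using harm_unbounded[of "C * S"] by (meson not_less)
qed

theorem theorem2p5:
  shows "frechet_space dirichlet_scale H_plus_topology \<and>
    schwartz_space dirichlet_scale H_plus_topology \<and>
    \<not> nuclear_space dirichlet_scale H_plus_topology \<and>
    frechet_algebra dirichlet_scale H_plus_topology dirichlet_mult \<and>
    schauder_basis dirichlet_scale H_plus_topology (\<lambda>n. dirichlet_monomial (Suc n)) \<and>
    unconditional_basis dirichlet_scale H_plus_topology (\<lambda>n. dirichlet_monomial (Suc n)) \<and>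
    \<not> absolute_basis dirichlet_scale H_plus_topology (\<lambda>n. dirichlet_monomial (Suc n))"
  by (intro conjI frechet_space_H_plus schwartz_space_H_plus not_nuclear_H_plus frechet_algebra_H_plus
      schauder_basis_monomials unconditional_basis_monomials not_absolute_basis_monomials)

end
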